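(* Let $\alpha_n:=\sqrt{\frac{n+2}{n+3}}$ ($n\ge0$), let $\alpha\equiv\{\alpha_n\}_{n=0}^\infty$, and let $x>0$. (a) $W_{\alpha(\sqrt x)}^2$ is quadratically hyponormal if and only if $x\le\frac{9}{10}$. (b) If $\ell\ge3$ is an integer and $x\le\dfrac{(\ell+1)^2(1+7\ell+34\ell^2+44\ell^3)}{2(1+9\ell+45\ell^2+99\ell^3+94\ell^4)}$, then $W_{\alpha(\sqrt x)}^{\ell}$ is quadratically hyponormal.
   Context: For a bounded sequence of positive numbers (weights) $\omega=\{\omega_n\}_{n=0}^\infty$, the weighted shift $W_\omega$ is the bounded operator on $\ell^2(\mathbf{Z}_+)$ with $W_\omega e_n:=\omega_n e_{n+1}$ ($n\ge 0$), where $\{e_n\}$ is the canonical orthonormal basis. For $y>0$, $\alpha(y)$ is the back-step extension $y,\alpha_0,\alpha_1,\alpha_2,\dots$. An operator $T$ is hyponormal if $T^*T\ge TT^*$, and quadratically hyponormal if $T+sT^2$ is hyponormal for every $s\in\mathbf{C}$. *)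

theory Defs
  imports "HOL-Analysis.Analysis"
begin

typedef ell2 = "{f :: nat \<Rightarrow> complex. summable (\<lambda>n. (cmod (f n))\<^sup>2)}"
  morphisms coord Abs_ell2
  by (rule exI[of _ "\<lambda>_. 0"]) simp

setup_lifting type_definition_ell2

lemma summable_coord: "summable (\<lambda>n. (cmod (coord f n))\<^sup>2)"
  using coord[of f] by simp

lemma ell2_eqI: "(\<And>n. coord f n = coord g n) \<Longrightarrow> f = g"
  by (simp add: coord_inject[symmetric] fun_eq_iff)

lemma ell2_add_aux:
  assumes "summable (\<lambda>n. (cmod (f n))\<^sup>2)" "summable (\<lambda>n. (cmod (g n))\<^sup>2)"
  shows "summable (\<lambda>n. (cmod (f n + g n))\<^sup>2)"
proof (rule summable_comparison_test')
  show "summable (\<lambda>n. 2 * (cmod (f n))\<^sup>2 + 2 * (cmod (g n))\<^sup>2)"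
    using assms by (intro summable_add summable_mult)
  fix n :: nat
  have "(cmod (f n + g n))\<^sup>2 \<le> (cmod (f n) + cmod (g n))\<^sup>2"
    by (intro power_mono norm_triangle_ineq) simp
  also have "\<dots> \<le> 2 * (cmod (f n))\<^sup>2 + 2 * (cmod (g n))\<^sup>2"
    using zero_le_power2[of "cmod (f n) - cmod (g n)"]
    by (simp add: power2_eq_square algebra_simps)
  finally show "norm ((cmod (f n + g n))\<^sup>2) \<le> 2 * (cmod (f n))\<^sup>2 + 2 * (cmod (g n))\<^sup>2"
    by simp
qed

lift_definition scaleC :: "complex \<Rightarrow> ell2 \<Rightarrow> ell2" (infixr "*\<^sub>C" 75)
  is "\<lambda>c f n. c * f n"
  by (simp add: norm_mult power_mult_distrib summable_mult)

definition cinner :: "ell2 \<Rightarrow> ell2 \<Rightarrow> complex" where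
  "cinner f g = (\<Sum>n. coord f n * cnj (coord g n))"

lemma summable_cinner: "summable (\<lambda>n. coord f n * cnj (coord g n))"
proof (rule summable_comparison_test')
  show "summable (\<lambda>n. (cmod (coord f n))\<^sup>2 + (cmod (coord g n))\<^sup>2)"
    by (intro summable_add summable_coord)
  fix n :: nat
  have "2 * (cmod (coord f n) * cmod (coord g n)) \<le> (cmod (coord f n))\<^sup>2 + (cmod (coord g n))\<^sup>2"
    using sum_squares_bound[of "cmod (coord f n)" "cmod (coord g n)"] by simp
  moreover have "0 \<le> cmod (coord f n) * cmod (coord g n)" by simp
  ultimately show "norm (coord f n * cnj (coord g n)) \<le> (cmod (coord f n))\<^sup>2 + (cmod (coord g n))\<^sup>2"
    unfolding norm_mult complex_mod_cnj by linarith
qed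

text \<open>The library has no class of complex inner product spaces; the norm and topology of
  \<open>ell2\<close> come from the underlying real inner product \<open>Re (cinner f g)\<close>.\<close>

instantiation ell2 :: real_vector
begin

lift_definition zero_ell2 :: ell2 is "\<lambda>_. 0" by simp
lift_definition plus_ell2 :: "ell2 \<Rightarrow> ell2 \<Rightarrow> ell2" is "\<lambda>f g n. f n + g n"
  by (rule ell2_add_aux)
lift_definition uminus_ell2 :: "ell2 \<Rightarrow> ell2" is "\<lambda>f n. - f n" by simp
definition minus_ell2 :: "ell2 \<Rightarrow> ell2 \<Rightarrow> ell2" where "f - g = f + - g" for f g :: ell2
definition scaleR_ell2 :: "real \<Rightarrow> ell2 \<Rightarrow> ell2" where "r *\<^sub>R f = complex_of_real r *\<^sub>C f" for f :: ell2

instance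
proof
  fix f g h :: ell2 and r s :: real
  show "f + g + h = f + (g + h)" by transfer (simp add: add.assoc)
  show "f + g = g + f" by transfer (simp add: add.commute)
  show "0 + f = f" by transfer simp
  show "- f + f = 0" by transfer simp
  show "f - g = f + - g" by (rule minus_ell2_def)
  show "r *\<^sub>R (f + g) = r *\<^sub>R f + r *\<^sub>R g"
    unfolding scaleR_ell2_def by transfer (simp add: algebra_simps)
  show "(r + s) *\<^sub>R f = r *\<^sub>R f + s *\<^sub>R f"
    unfolding scaleR_ell2_def by transfer (simp add: algebra_simps)
  show "r *\<^sub>R s *\<^sub>R f = (r * s) *\<^sub>R f"
    unfolding scaleR_ell2_def by transfer (simp add: algebra_simps)
  show "1 *\<^sub>R f = f" unfolding scaleR_ell2_def by transfer simp
qed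

end

instantiation ell2 :: real_inner
begin

definition inner_ell2 :: "ell2 \<Rightarrow> ell2 \<Rightarrow> real" where "f \<bullet> g = Re (cinner f g)" for f g :: ell2
definition norm_ell2 :: "ell2 \<Rightarrow> real" where "norm f = sqrt (f \<bullet> f)" for f :: ell2
definition sgn_ell2 :: "ell2 \<Rightarrow> ell2" where "sgn f = f /\<^sub>R norm f" for f :: ell2
definition dist_ell2 :: "ell2 \<Rightarrow> ell2 \<Rightarrow> real" where "dist f g = norm (f - g)" for f g :: ell2
definition uniformity_ell2 :: "(ell2 \<times> ell2) filter" where
  "uniformity = (INF e\<in>{0<..}. principal {(f :: ell2, g). dist f g < e})"
definition open_ell2 :: "ell2 set \<Rightarrow> bool" where
  "open U \<longleftrightarrow> (\<forall>f\<in>U. eventually (\<lambda>(f', g). f' = f \<longrightarrow> g \<in> U) uniformity)" for U :: "ell2 set"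

lemma inner_ell2_sum: "f \<bullet> g = (\<Sum>n. Re (coord f n * cnj (coord g n)))"
  "summable (\<lambda>n. Re (coord f n * cnj (coord g n)))" for f g :: ell2
  using sums_Re[OF summable_sums[OF summable_cinner[of f g]]]
  by (auto simp: inner_ell2_def cinner_def sums_iff)

lemma inner_ell2_self: "f \<bullet> f = (\<Sum>n. (cmod (coord f n))\<^sup>2)" for f :: ell2
  unfolding inner_ell2_sum(1) by (simp add: cmod_def power2_eq_square)

instance
proof
  fix f g h :: ell2 and r s :: real
  show "dist f g = norm (f - g)" by (rule dist_ell2_def)
  show "sgn f = f /\<^sub>R norm f" by (rule sgn_ell2_def)
  show "uniformity = (INF e\<in>{0<..}. principal {(f :: ell2, g). dist f g < e})"
    by (rule uniformity_ell2_def)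
  show "open U = (\<forall>f\<in>U. eventually (\<lambda>(f', g). f' = f \<longrightarrow> g \<in> U) uniformity)" for U :: "ell2 set"
    by (rule open_ell2_def)
  show "f \<bullet> g = g \<bullet> f"
    unfolding inner_ell2_sum(1) by (simp add: mult.commute)
  show "(f + g) \<bullet> h = f \<bullet> h + g \<bullet> h"
    unfolding inner_ell2_sum(1)
    by (subst suminf_add[OF inner_ell2_sum(2) inner_ell2_sum(2)])
       (simp add: plus_ell2.rep_eq algebra_simps)
  show "r *\<^sub>R f \<bullet> g = r * (f \<bullet> g)"
    unfolding inner_ell2_sum(1)
    by (subst suminf_mult[OF inner_ell2_sum(2), symmetric])
       (simp add: scaleR_ell2_def scaleC.rep_eq algebra_simps)
  show "0 \<le> f \<bullet> f"
    unfolding inner_ell2_self by (intro suminf_nonneg summable_coord) simp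
  show "f \<bullet> f = 0 \<longleftrightarrow> f = 0"
    unfolding inner_ell2_self
    by (subst suminf_eq_zero_iff[OF summable_coord])
       (auto simp: coord_inject[symmetric] zero_ell2.rep_eq fun_eq_iff)
  show "norm f = sqrt (f \<bullet> f)" by (rule norm_ell2_def)
qed

end

lemma coord_minus: "coord (f - g) n = coord f n - coord g n"
  unfolding minus_ell2_def plus_ell2.rep_eq uminus_ell2.rep_eq by simp

lemma norm_ell2_eq: "norm f = sqrt (\<Sum>n. (cmod (coord f n))\<^sup>2)"
  by (simp add: norm_ell2_def inner_ell2_self)

definition bounded_clinear :: "(ell2 \<Rightarrow> ell2) \<Rightarrow> bool" where
  "bounded_clinear T \<longleftrightarrow> bounded_linear T \<and> (\<forall>c f. T (c *\<^sub>C f) = c *\<^sub>C T f)"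

definition is_adjoint :: "(ell2 \<Rightarrow> ell2) \<Rightarrow> (ell2 \<Rightarrow> ell2) \<Rightarrow> bool" where
  "is_adjoint T S \<longleftrightarrow> (\<forall>f g. cinner (T f) g = cinner f (S g))"

text \<open>Every bounded operator has exactly one adjoint; for functions without an adjoint the
  value is unspecified.\<close>

definition op_adjoint :: "(ell2 \<Rightarrow> ell2) \<Rightarrow> ell2 \<Rightarrow> ell2" where
  "op_adjoint T = (THE S. is_adjoint T S)"

lemma cinner_diff_right: "cinner f (g - h) = cinner f g - cinner f h"
  unfolding cinner_def
  by (subst suminf_diff[OF summable_cinner summable_cinner])
     (simp add: coord_minus algebra_simps)

lemma op_adjoint_eqI:
  assumes "is_adjoint T S"
  shows "op_adjoint T = S"
  unfolding op_adjoint_def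
proof (rule the_equality)
  fix S' assume "is_adjoint T S'"
  with assms have "cinner f (S' g - S g) = 0" for f g
    by (simp add: is_adjoint_def cinner_diff_right)
  then have "(S' g - S g) \<bullet> (S' g - S g) = 0" for g
    unfolding inner_ell2_def by simp
  then show "S' = S" by (simp add: fun_eq_iff)
qed (fact assms)

text \<open>The order on operators: \<open>B - A\<close> is a positive operator.\<close>

definition op_le :: "(ell2 \<Rightarrow> ell2) \<Rightarrow> (ell2 \<Rightarrow> ell2) \<Rightarrow> bool" where
  "op_le A B \<longleftrightarrow> (\<forall>f. cinner (B f - A f) f \<in> \<real>\<^sub>\<ge>\<^sub>0)"

definition hyponormal :: "(ell2 \<Rightarrow> ell2) \<Rightarrow> bool" where
  "hyponormal T \<longleftrightarrow> bounded_clinear T \<and> op_le (T \<circ> op_adjoint T) (op_adjoint T \<circ> T)"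

definition quadratically_hyponormal :: "(ell2 \<Rightarrow> ell2) \<Rightarrow> bool" where
  "quadratically_hyponormal T \<longleftrightarrow> (\<forall>s :: complex. hyponormal (\<lambda>f. T f + s *\<^sub>C (T ^^ 2) f))"

lift_definition ebasis :: "nat \<Rightarrow> ell2" is "\<lambda>k n. if n = k then 1 else 0"
proof -
  fix k :: nat
  show "summable (\<lambda>n. (cmod (if n = k then 1 else 0))\<^sup>2)"
    by (rule summable_finite[of "{k}"]) auto
qed

text \<open>Only meaningful for bounded weight sequences, as otherwise the image sequence may fail to
  be square summable.  Then \<open>weighted_shift_ebasis\<close> and
  \<open>bounded_clinear_weighted_shift\<close> below characterise the shift as the bounded operator with
  \<open>W e\<^sub>n = \<omega>\<^sub>n e\<^sub>n\<^sub>+\<^sub>1\<close>.\<close>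

definition weighted_shift :: "(nat \<Rightarrow> real) \<Rightarrow> ell2 \<Rightarrow> ell2" where
  "weighted_shift \<omega> f =
     Abs_ell2 (\<lambda>n. case n of 0 \<Rightarrow> 0 | Suc k \<Rightarrow> complex_of_real (\<omega> k) * coord f k)"

lemma weighted_shift_bound:
  assumes "\<And>k. \<bar>\<omega> k\<bar> \<le> B"
  shows "(cmod (complex_of_real (\<omega> k) * coord f k))\<^sup>2 \<le> B\<^sup>2 * (cmod (coord f k))\<^sup>2"
proof -
  have "\<bar>\<omega> k\<bar>\<^sup>2 \<le> B\<^sup>2" using assms by (intro power_mono) auto
  then show ?thesis by (simp add: norm_mult power_mult_distrib mult_right_mono)
qed

lemma coord_weighted_shift:
  assumes "bounded (range \<omega>)"
  shows "coord (weighted_shift \<omega> f) =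
     (\<lambda>n. case n of 0 \<Rightarrow> 0 | Suc k \<Rightarrow> complex_of_real (\<omega> k) * coord f k)" (is "_ = ?g")
proof -
  obtain B where B: "\<And>k. \<bar>\<omega> k\<bar> \<le> B"
    using assms by (auto simp: bounded_iff)
  have "summable (\<lambda>k. (cmod (?g (Suc k)))\<^sup>2)"
    using weighted_shift_bound[of \<omega> B, OF B]
    by (intro summable_comparison_test'[OF summable_mult[OF summable_coord[of f], of "B\<^sup>2"]])
       (simp del: norm_mult)
  then have "summable (\<lambda>k. (cmod (?g k))\<^sup>2)"
    by (rule summable_Suc_iff[THEN iffD1])
  then show ?thesis
    unfolding weighted_shift_def by (intro Abs_ell2_inverse) (simp only: mem_Collect_eq)
qed

lemma weighted_shift_ebasis:
  assumes "bounded (range \<omega>)"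
  shows "weighted_shift \<omega> (ebasis n) = \<omega> n *\<^sub>R ebasis (Suc n)"
  by (rule ell2_eqI)
     (simp add: coord_weighted_shift[OF assms] ebasis.rep_eq scaleR_ell2_def scaleC.rep_eq
       split: nat.split)

lemma bounded_clinear_weighted_shift:
  assumes "bounded (range \<omega>)"
  shows "bounded_clinear (weighted_shift \<omega>)"
proof -
  obtain B where B: "\<And>k. \<bar>\<omega> k\<bar> \<le> B"
    using assms by (auto simp: bounded_iff)
  note c = coord_weighted_shift[OF assms]
  have "bounded_linear (weighted_shift \<omega>)"
  proof (rule bounded_linear_intro[of _ B])
    show "weighted_shift \<omega> (f + g) = weighted_shift \<omega> f + weighted_shift \<omega> g" for f g
      by (rule ell2_eqI) (simp add: c plus_ell2.rep_eq distrib_left split: nat.split)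
    show "weighted_shift \<omega> (r *\<^sub>R f) = r *\<^sub>R weighted_shift \<omega> f" for r f
      by (rule ell2_eqI) (simp add: c scaleR_ell2_def scaleC.rep_eq split: nat.split)
    fix f
    have "0 \<le> B" using B[of 0] by linarith
    have "(\<Sum>n. (cmod (coord (weighted_shift \<omega> f) n))\<^sup>2)
        = (\<Sum>n. (cmod (coord (weighted_shift \<omega> f) (Suc n)))\<^sup>2)"
      by (subst suminf_split_head[OF summable_coord]) (simp add: c)
    also have "\<dots> = (\<Sum>n. (cmod (complex_of_real (\<omega> n) * coord f n))\<^sup>2)"
      by (simp add: c)
    also have "\<dots> \<le> (\<Sum>n. B\<^sup>2 * (cmod (coord f n))\<^sup>2)"
    proof (intro suminf_le weighted_shift_bound B summable_mult summable_coord)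
      have "summable (\<lambda>n. (cmod (coord (weighted_shift \<omega> f) (Suc n)))\<^sup>2)"
        by (rule summable_Suc_iff[THEN iffD2]) (rule summable_coord)
      then show "summable (\<lambda>n. (cmod (complex_of_real (\<omega> n) * coord f n))\<^sup>2)" by (simp add: c)
    qed
    also have "\<dots> = B\<^sup>2 * (\<Sum>n. (cmod (coord f n))\<^sup>2)"
      by (rule suminf_mult[OF summable_coord])
    finally have "sqrt (\<Sum>n. (cmod (coord (weighted_shift \<omega> f) n))\<^sup>2)
        \<le> sqrt (B\<^sup>2 * (\<Sum>n. (cmod (coord f n))\<^sup>2))" by (rule real_sqrt_le_mono)
    then show "norm (weighted_shift \<omega> f) \<le> norm f * B"
      using \<open>0 \<le> B\<close> by (simp add: norm_ell2_eq real_sqrt_mult mult.commute)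
  qed
  moreover have "weighted_shift \<omega> (a *\<^sub>C f) = a *\<^sub>C weighted_shift \<omega> f" for a f
    by (rule ell2_eqI) (simp add: c scaleC.rep_eq split: nat.split)
  ultimately show ?thesis by (simp add: bounded_clinear_def)
qed

definition back_step :: "real \<Rightarrow> (nat \<Rightarrow> real) \<Rightarrow> nat \<Rightarrow> real" where
  "back_step y \<alpha> n = (case n of 0 \<Rightarrow> y | Suc k \<Rightarrow> \<alpha> k)"

end

theory Submission
  imports Defs
begin

text \<open>The shift in question is the Bergman shift, whose squared weights are
  \<open>(n + 1) / (n + 2)\<close>, with the first squared weight \<open>1 / 2\<close> replaced by \<open>x\<close>.  Its power \<open>W\<^sup>l\<close>
  is an orthogonal sum of \<open>l\<close> weighted shifts, one for each residue class modulo \<open>l\<close>.  Telescoping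
  products show that every one of them has squared weights \<open>(k + a) / (k + 1 + a)\<close> for some
  \<open>a > 0\<close>, except that in the class of \<open>0\<close> (where \<open>a = 1 / l\<close>) the first one is
  \<open>y = 2 x / (l + 1)\<close>.

  For a weighted shift \<open>T\<close> with squared weights \<open>U\<close> and \<open>t = |s|\<^sup>2\<close>, hyponormality of \<open>T + s T\<^sup>2\<close> means
  that the Hermitian form \<open>\<parallel>(T + s T\<^sup>2) f\<parallel>\<^sup>2 - \<parallel>(T + s T\<^sup>2)\<^sup>* f\<parallel>\<^sup>2\<close> is positive.  This form is
  tridiagonal, with diagonal entries \<open>q\<^sub>k = A\<^sub>k + t B\<^sub>k\<close> and off-diagonal entries of squared modulus
  \<open>t w\<^sub>k\<close>.  It is positive as soon as each \<open>q\<^sub>k\<close> can be split as \<open>c\<^sub>k + e\<^sub>k\<close> with nonnegative parts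
  and \<open>t w\<^sub>k \<le> c\<^sub>k e\<^sub>k\<^sub>+\<^sub>1\<close>, for then it is a sum of positive \<open>2 \<times> 2\<close> blocks
  (\<open>quadratically_hyponormal_of_splits\<close>).  With \<open>m = k + a\<close> the unperturbed entries are
  \<open>A\<^sub>k = 1 / (m (m + 1))\<close>, \<open>B\<^sub>k = 4 / (m (m + 2))\<close> and \<open>w\<^sub>k = 4 / (m (m + 1) (m + 2)\<^sup>2)\<close>.
  Two splittings suggest themselves.  As \<open>(m + 1) (m + 3) < (m + 2)\<^sup>2\<close>, one has
  \<open>w\<^sub>k < A\<^sub>k B\<^sub>k\<^sub>+\<^sub>1\<close>, so \<open>c = A\<close>, \<open>e = t B\<close> works; this settles all unperturbed classes
  (\<open>splits_bergman_type\<close>).  Moreover \<open>w\<^sub>k = B\<^sub>k A\<^sub>k\<^sub>+\<^sub>1\<close> exactly, so \<open>c = t B\<close>, \<open>e = A\<close> works as well.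

  In the perturbed class the rows \<open>0\<close>, \<open>1\<close>, \<open>2\<close> are eliminated by Schur complements, and the rows from
  \<open>3\<close> on are split in one of these two ways.  The second splitting demands little of row \<open>2\<close> when \<open>t\<close>
  is small, and a refinement of the first one demands little when \<open>t\<close> is large.  What remains is to
  show that one polynomial in \<open>a\<close>, \<open>y\<close>, \<open>t\<close> is nonnegative for \<open>t \<le> 3 / 10\<close> and another one for
  \<open>t \<ge> 3 / 10\<close>; both are affine in \<open>y\<close>.  All of it follows from two affine conditions on \<open>y\<close>
  (\<open>splits_perturbed_bergman_type\<close>): the bound \<open>y \<le> U\<^sub>1\<close>, which is hyponormality of \<open>T\<close>, and the
  nonnegativity of the first polynomial at \<open>t = 3 / 10\<close>.  Both hold for \<open>l = 2\<close>, \<open>x \<le> 9 / 10\<close>, and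
  for \<open>l \<ge> 3\<close> and \<open>x\<close> below the given bound.  Conversely, if \<open>W\<^sup>2\<close> is hyponormal, then the form with
  \<open>s = 0\<close>, evaluated at \<open>e\<^sub>2\<close>, gives \<open>2 x / 3 \<le> 3 / 5\<close>.\<close>

section \<open>Adjoints and hyponormality\<close>

lemma cinner_add_left: "cinner (f + g) h = cinner f h + cinner g h"
  unfolding cinner_def
  by (subst suminf_add[OF summable_cinner summable_cinner])
     (simp add: plus_ell2.rep_eq algebra_simps)

lemma cinner_add_right: "cinner f (g + h) = cinner f g + cinner f h"
  unfolding cinner_def
  by (subst suminf_add[OF summable_cinner summable_cinner])
     (simp add: plus_ell2.rep_eq algebra_simps)

lemma cinner_scaleC_left: "cinner (c *\<^sub>C f) g = c * cinner f g"
  unfolding cinner_def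
  by (subst suminf_mult[OF summable_cinner, symmetric]) (simp add: scaleC.rep_eq algebra_simps)

lemma cinner_scaleC_right: "cinner f (c *\<^sub>C g) = cnj c * cinner f g"
  unfolding cinner_def
  by (subst suminf_mult[OF summable_cinner, symmetric]) (simp add: scaleC.rep_eq algebra_simps)

lemma cinner_commute: "cinner g f = cnj (cinner f g)"
  using sums_cnj[THEN iffD2, OF summable_sums[OF summable_cinner[of f g]]]
  unfolding cinner_def by (simp add: sums_iff mult.commute)

lemma norm_ell2_power2: "(norm f)\<^sup>2 = (\<Sum>n. (cmod (coord f n))\<^sup>2)"
  unfolding norm_ell2_eq by (simp add: suminf_nonneg summable_coord)

lemma cinner_self: "cinner f f = complex_of_real ((norm f)\<^sup>2)"
proof -
  have "(\<lambda>n. complex_of_real ((cmod (coord f n))\<^sup>2)) sums complex_of_real ((norm f)\<^sup>2)"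
    unfolding norm_ell2_power2 by (intro sums_of_real summable_sums summable_coord)
  moreover have "complex_of_real ((cmod (coord f n))\<^sup>2) = coord f n * cnj (coord f n)" for n
    by (rule complex_norm_square)
  ultimately show ?thesis by (simp add: cinner_def sums_iff)
qed

lemma norm_scaleC: "norm (c *\<^sub>C f) = cmod c * norm f"
proof (rule power2_eq_imp_eq)
  show "(norm (c *\<^sub>C f))\<^sup>2 = (cmod c * norm f)\<^sup>2"
    unfolding norm_ell2_power2 power_mult_distrib
    by (subst suminf_mult[OF summable_coord, symmetric])
       (simp add: scaleC.rep_eq norm_mult power_mult_distrib)
qed simp_all

lemma scaleC_add_right: "c *\<^sub>C (f + g) = c *\<^sub>C f + c *\<^sub>C g"
  by (rule ell2_eqI) (simp add: scaleC.rep_eq plus_ell2.rep_eq algebra_simps)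

lemma scaleC_scaleC: "c *\<^sub>C d *\<^sub>C f = (c * d) *\<^sub>C f"
  by (rule ell2_eqI) (simp add: scaleC.rep_eq)

lemma scaleC_zero_left: "0 *\<^sub>C f = 0"
  by (rule ell2_eqI) (simp add: scaleC.rep_eq zero_ell2.rep_eq)

lemma is_adjoint_funpow:
  assumes "is_adjoint T S"
  shows "is_adjoint (T ^^ n) (S ^^ n)"
proof (induction n)
  case (Suc n)
  then have "cinner (T ((T ^^ n) f)) g = cinner f ((S ^^ n) (S g))" for f g
    using assms by (simp add: is_adjoint_def)
  then show ?case by (simp add: is_adjoint_def funpow_swap1)
qed (simp add: is_adjoint_def)

lemma is_adjoint_add_scaleC:
  assumes "is_adjoint T S" "is_adjoint T' S'"
  shows "is_adjoint (\<lambda>f. T f + c *\<^sub>C T' f) (\<lambda>f. S f + cnj c *\<^sub>C S' f)"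
  using assms
  by (simp add: is_adjoint_def cinner_add_left cinner_add_right cinner_scaleC_left cinner_scaleC_right)

lemma bounded_clinear_funpow:
  assumes "bounded_clinear T"
  shows "bounded_clinear (T ^^ n)"
proof (induction n)
  case 0
  then show ?case by (simp add: bounded_clinear_def bounded_linear_ident id_def)
next
  case (Suc n)
  have "bounded_linear (\<lambda>f. T ((T ^^ n) f))"
    using assms Suc by (auto simp: bounded_clinear_def intro: bounded_linear_compose)
  with assms Suc show ?case by (simp add: bounded_clinear_def comp_def)
qed

lemma bounded_clinear_add_scaleC:
  assumes "bounded_clinear T" "bounded_clinear T'"
  shows "bounded_clinear (\<lambda>f. T f + c *\<^sub>C T' f)"
proof -
  have "bounded_linear (\<lambda>f. c *\<^sub>C f)"
    by (rule bounded_linear_intro[of _ "cmod c"])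
       (simp_all add: norm_scaleC scaleC_add_right scaleC_scaleC scaleR_ell2_def mult.commute)
  then have "bounded_linear (\<lambda>f. T f + c *\<^sub>C T' f)"
    using assms
    by (auto simp: bounded_clinear_def intro!: bounded_linear_add elim: bounded_linear_compose)
  then show ?thesis
    using assms by (simp add: bounded_clinear_def scaleC_add_right scaleC_scaleC mult.commute)
qed

text \<open>\<open>T\<^sup>*T - TT\<^sup>*\<close> has the quadratic form \<open>\<parallel>T f\<parallel>\<^sup>2 - \<parallel>T\<^sup>* f\<parallel>\<^sup>2\<close>.\<close>
lemma hyponormal_iff_norm_le:
  assumes T: "bounded_clinear T" and adj: "is_adjoint T S"
  shows "hyponormal T \<longleftrightarrow> (\<forall>f. norm (S f) \<le> norm (T f))"
proof -
  have "cinner (S (T f) - T (S f)) f = complex_of_real ((norm (T f))\<^sup>2 - (norm (S f))\<^sup>2)" for f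
  proof -
    have "cinner f (S (T f) - T (S f)) = cinner f (S (T f)) - cnj (cinner (T (S f)) f)"
      by (simp add: cinner_diff_right cinner_commute[of f "T (S f)"])
    also have "\<dots> = cinner (T f) (T f) - cnj (cinner (S f) (S f))"
      using adj by (simp add: is_adjoint_def)
    finally show ?thesis
      by (subst cinner_commute) (simp add: cinner_self)
  qed
  then show ?thesis
    using T op_adjoint_eqI[OF adj]
    by (simp add: hyponormal_def op_le_def nonneg_Reals_of_real_iff del: of_real_diff of_real_power)
qed

section \<open>Powers of a weighted shift\<close>

definition backward_shift :: "(nat \<Rightarrow> real) \<Rightarrow> ell2 \<Rightarrow> ell2" where
  "backward_shift \<omega> f = Abs_ell2 (\<lambda>n. complex_of_real (\<omega> n) * coord f (Suc n))"

lemma coord_backward_shift: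
  assumes "bounded (range \<omega>)"
  shows "coord (backward_shift \<omega> f) n = complex_of_real (\<omega> n) * coord f (Suc n)"
proof -
  obtain B where B: "\<And>k. \<bar>\<omega> k\<bar> \<le> B"
    using assms by (auto simp: bounded_iff)
  have "summable (\<lambda>n. (cmod (complex_of_real (\<omega> n) * coord f (Suc n)))\<^sup>2)"
  proof (rule summable_comparison_test')
    show "summable (\<lambda>n. B\<^sup>2 * (cmod (coord f (Suc n)))\<^sup>2)"
      by (intro summable_mult summable_Suc_iff[THEN iffD2] summable_coord)
    fix n
    have "\<bar>\<omega> n\<bar>\<^sup>2 \<le> B\<^sup>2" using B by (intro power_mono) auto
    then show "norm ((cmod (complex_of_real (\<omega> n) * coord f (Suc n)))\<^sup>2)
        \<le> B\<^sup>2 * (cmod (coord f (Suc n)))\<^sup>2"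
      by (simp add: norm_mult power_mult_distrib mult_right_mono)
  qed
  then show ?thesis
    unfolding backward_shift_def by (subst Abs_ell2_inverse) simp_all
qed

lemma is_adjoint_weighted_shift:
  assumes "bounded (range \<omega>)"
  shows "is_adjoint (weighted_shift \<omega>) (backward_shift \<omega>)"
  unfolding is_adjoint_def
proof (intro allI)
  fix f g
  have "cinner (weighted_shift \<omega> f) g
      = (\<Sum>n. coord (weighted_shift \<omega> f) (Suc n) * cnj (coord g (Suc n)))"
    unfolding cinner_def
    by (subst suminf_split_head[OF summable_cinner]) (simp add: coord_weighted_shift[OF assms])
  also have "\<dots> = cinner f (backward_shift \<omega> g)"
    unfolding cinner_def
    by (simp add: coord_weighted_shift[OF assms] coord_backward_shift[OF assms] ac_simps)
  finally show "cinner (weighted_shift \<omega> f) g = cinner f (backward_shift \<omega> g)" .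
qed

text \<open>The weights of the power: \<open>W\<^sup>l e\<^sub>n\<close> is \<open>block_weight \<omega> l n\<close> times \<open>e\<^sub>n\<^sub>+\<^sub>l\<close>.\<close>
definition block_weight :: "(nat \<Rightarrow> real) \<Rightarrow> nat \<Rightarrow> nat \<Rightarrow> real" where
  "block_weight \<omega> l n = (\<Prod>i<l. \<omega> (n + i))"

lemma coord_weighted_shift_funpow:
  assumes "bounded (range \<omega>)"
  shows "coord ((weighted_shift \<omega> ^^ l) f) n =
    (if n < l then 0 else complex_of_real (block_weight \<omega> l (n - l)) * coord f (n - l))"
proof (induction l arbitrary: n)
  case 0
  then show ?case by (simp add: block_weight_def)
next
  case (Suc l)
  show ?case
  proof (cases n)
    case 0
    then show ?thesis by (simp add: coord_weighted_shift[OF assms])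
  next
    case (Suc k)
    then show ?thesis
      by (auto simp: coord_weighted_shift[OF assms] Suc.IH block_weight_def)
  qed
qed

lemma coord_backward_shift_funpow:
  assumes "bounded (range \<omega>)"
  shows "coord ((backward_shift \<omega> ^^ l) f) n
    = complex_of_real (block_weight \<omega> l n) * coord f (n + l)"
proof (induction l arbitrary: n)
  case 0
  then show ?case by (simp add: block_weight_def)
next
  case (Suc l)
  have "block_weight \<omega> (Suc l) n = \<omega> n * block_weight \<omega> l (Suc n)"
    unfolding block_weight_def by (subst prod.lessThan_Suc_shift) simp
  then show ?case
    by (simp add: coord_backward_shift[OF assms] Suc.IH)
qed

lemma bounded_block_weight:
  assumes "bounded (range \<omega>)"
  shows "bounded (range (block_weight \<omega> l))"
proof -
  obtain B where B: "\<And>k. \<bar>\<omega> k\<bar> \<le> B"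
    using assms by (auto simp: bounded_iff)
  have "\<bar>block_weight \<omega> l n\<bar> \<le> (\<Prod>i<l. B)" for n
    unfolding block_weight_def abs_prod using B by (intro prod_mono) auto
  then show ?thesis by (auto simp: bounded_iff)
qed

section \<open>Split certificates for tridiagonal forms\<close>

definition lag :: "nat \<Rightarrow> (nat \<Rightarrow> real) \<Rightarrow> nat \<Rightarrow> real" where
  "lag k u n = (if n < k then 0 else u (n - k))"

text \<open>Let \<open>T\<close> map \<open>e\<^sub>n\<close> to \<open>\<surd>u\<^sub>n e\<^sub>n\<^sub>+\<^sub>l\<close> and let \<open>t = |s|\<^sup>2\<close>.  In the form
  \<open>\<parallel>(T + s T\<^sup>2) f\<parallel>\<^sup>2 - \<parallel>(T + s T\<^sup>2)\<^sup>* f\<parallel>\<^sup>2\<close> the coefficient of \<open>|f\<^sub>n|\<^sup>2\<close> is \<open>diag_entry\<close>, and the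
  coefficient coupling \<open>f\<^sub>n\<close> with \<open>f\<^sub>n\<^sub>+\<^sub>l\<close> has squared modulus \<open>t\<close> times \<open>link_entry\<close>.\<close>
definition diag_entry :: "nat \<Rightarrow> (nat \<Rightarrow> real) \<Rightarrow> real \<Rightarrow> nat \<Rightarrow> real" where
  "diag_entry l u t n = (u n - lag l u n) + t * (u n * u (n + l) - lag l u n * lag (2 * l) u n)"

definition link_entry :: "nat \<Rightarrow> (nat \<Rightarrow> real) \<Rightarrow> nat \<Rightarrow> real" where
  "link_entry l u n = u n * (u (n + l) - lag l u n)\<^sup>2"

text \<open>A certificate that the form is positive: the diagonal entry at \<open>n\<close> is large enough to give a share
  \<open>c n\<close> to the coupling with \<open>n + l\<close> and a share \<open>e n\<close> to the coupling with \<open>n - l\<close>, such that each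
  coupling is dominated by the two shares it receives.\<close>
definition splits :: "nat \<Rightarrow> (nat \<Rightarrow> real) \<Rightarrow> real \<Rightarrow> bool" where
  "splits l u t \<longleftrightarrow> (\<exists>c e. \<forall>n. 0 \<le> c n \<and> 0 \<le> e n \<and> c n + e n \<le> diag_entry l u t n \<and>
     t * link_entry l u n \<le> c n * e (n + l))"

text \<open>For \<open>s = 0\<close> there is no coupling, so monotone weights are enough.\<close>
lemma splits_zero:
  assumes "\<And>n. lag l u n \<le> u n"
  shows "splits l u 0"
  unfolding splits_def
  by (rule exI[of _ "\<lambda>n. u n - lag l u n"], rule exI[of _ "\<lambda>_. 0"])
     (use assms in \<open>simp add: diag_entry_def\<close>)

text \<open>Only indices congruent modulo \<open>l\<close> are coupled, so the certificate can be found separately in each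
  residue class; this is the decomposition of the \<open>l\<close>-th power into an orthogonal sum of \<open>l\<close> shifts.\<close>
lemma splits_residue_classes:
  assumes l: "l > 0" and classes: "\<And>r. r < l \<Longrightarrow> splits 1 (\<lambda>k. u (r + k * l)) t"
  shows "splits l u t"
proof -
  define V where "V r = (\<lambda>k. u (r + k * l))" for r
  have "\<forall>r\<in>{..<l}. \<exists>ce. \<forall>k. 0 \<le> fst ce k \<and> 0 \<le> snd ce k \<and>
      fst ce k + snd ce k \<le> diag_entry 1 (V r) t k \<and>
      t * link_entry 1 (V r) k \<le> fst ce k * snd ce (k + 1)"
    using classes unfolding splits_def V_def by force
  then obtain ce where ce: "\<And>r k. r < l \<Longrightarrow> 0 \<le> fst (ce r) k \<and> 0 \<le> snd (ce r) k \<and>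
      fst (ce r) k + snd (ce r) k \<le> diag_entry 1 (V r) t k \<and>
      t * link_entry 1 (V r) k \<le> fst (ce r) k * snd (ce r) (k + 1)"
    by (metis bchoice lessThan_iff)
  have u_eq: "u n = V (n mod l) (n div l)" for n
    by (simp add: V_def)
  have div_add: "(n + l) div l = n div l + 1" for n
    using l by simp
  have lag_V: "lag (j * l) u n = lag j (V (n mod l)) (n div l)" for j n
  proof (cases "n < j * l")
    case True
    then show ?thesis
      using l by (simp add: lag_def div_less_iff_less_mult)
  next
    case False
    have "n mod l + (n div l - j) * l = n - j * l"
    proof -
      have "j \<le> n div l"
        using False l by (simp add: less_eq_div_iff_mult_less_eq not_less)
      then have "j * l \<le> n div l * l" by simp
      then show ?thesis
        using div_mult_mod_eq[of n l] unfolding diff_mult_distrib by linarith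
    qed
    with False show ?thesis
      using l by (simp add: lag_def V_def div_less_iff_less_mult)
  qed
  have entries: "diag_entry l u t n = diag_entry 1 (V (n mod l)) t (n div l)"
    "link_entry l u n = link_entry 1 (V (n mod l)) (n div l)" for n
    using lag_V[of 1] lag_V[of 2] l
    by (simp_all add: diag_entry_def link_entry_def u_eq[of n] u_eq[of "n + l"] numeral_2_eq_2)
  show ?thesis
    unfolding splits_def
    by (rule exI[of _ "\<lambda>n. fst (ce (n mod l)) (n div l)"],
        rule exI[of _ "\<lambda>n. snd (ce (n mod l)) (n div l)"])
       (use ce l in \<open>simp add: entries\<close>)
qed

section \<open>The commutator form of a power of a weighted shift\<close>

lemma bounded_mult_range:
  fixes b c :: "nat \<Rightarrow> real"
  assumes "bounded (range b)" "bounded (range c)"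
  shows "bounded (range (\<lambda>n. b n * c n))"
proof -
  obtain B C where "\<And>n. \<bar>b n\<bar> \<le> B" "\<And>n. \<bar>c n\<bar> \<le> C"
    using assms by (auto simp: bounded_iff)
  then have "\<bar>b n * c n\<bar> \<le> B * C" for n
    unfolding abs_mult by (intro mult_mono) (auto intro: order_trans[OF abs_ge_zero])
  then show ?thesis by (auto simp: bounded_iff)
qed

lemma bounded_range_comp: "bounded (range b) \<Longrightarrow> bounded (range (\<lambda>n. b (g n)))"
  by (erule bounded_subset) auto

lemma bounded_range_lag: "bounded (range b) \<Longrightarrow> bounded (range (lag k b))"
  by (rule bounded_subset[of "insert 0 (range b)"]) (auto simp: lag_def)

lemma summable_bounded_times_coord:
  fixes b :: "nat \<Rightarrow> real"
  assumes "bounded (range b)"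
  shows "summable (\<lambda>n. b n * (cmod (coord f (n + k)))\<^sup>2)"
proof -
  obtain B where B: "\<And>n. \<bar>b n\<bar> \<le> B"
    using assms by (auto simp: bounded_iff)
  show ?thesis
  proof (rule summable_comparison_test')
    show "summable (\<lambda>n. B * (cmod (coord f (n + k)))\<^sup>2)"
      by (intro summable_mult summable_iff_shift[THEN iffD2] summable_coord)
    show "norm (b n * (cmod (coord f (n + k)))\<^sup>2) \<le> B * (cmod (coord f (n + k)))\<^sup>2" for n
      using B by (simp add: abs_mult mult_right_mono)
  qed
qed

lemma suminf_shift_of_zeros:
  fixes h :: "nat \<Rightarrow> real"
  assumes "summable h" "\<And>n. n < k \<Longrightarrow> h n = 0"
  shows "(\<Sum>n. h n) = (\<Sum>n. h (n + k))"
  using suminf_split_initial_segment[OF assms(1), of k] assms(2) by simp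

lemma cmod_add_scaled_power2:
  "(cmod (v + s * z))\<^sup>2 = (cmod v)\<^sup>2 + (cmod s)\<^sup>2 * (cmod z)\<^sup>2 + 2 * Re (cnj s * v * cnj z)"
  unfolding cmod_power2 by (simp add: power2_eq_square algebra_simps)

context
  fixes \<omega> :: "nat \<Rightarrow> real" and l :: nat and u :: "nat \<Rightarrow> real"
  assumes \<omega>: "bounded (range \<omega>)"
    and u: "\<And>n. u n = (block_weight \<omega> l n)\<^sup>2"
begin

lemma bounded_u: "bounded (range u)"
  using bounded_mult_range[OF bounded_block_weight[OF \<omega>, of l] bounded_block_weight[OF \<omega>, of l]]
  by (simp add: u[abs_def] power2_eq_square)

text \<open>Write \<open>f\<^sub>n\<close> for the coordinates of \<open>f\<close> and \<open>g = T f\<close>.  The coordinate of \<open>T f + s T\<^sup>2 f\<close> at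
  \<open>n + l\<close> is the weight at \<open>n\<close> times \<open>f\<^sub>n + s g\<^sub>n\<close>.  After expanding the square, the terms containing
  \<open>g\<close> vanish for \<open>n < l\<close>, and shifting their index by \<open>l\<close> expresses them in \<open>f\<close> alone.\<close>
lemma norm_power2_shift_combination:
  fixes f :: ell2 and s :: complex
  defines "T \<equiv> weighted_shift \<omega> ^^ l"
  defines "X \<equiv> \<lambda>n. 2 * Re (s * of_real (block_weight \<omega> l n) * coord f n * cnj (coord f (n + l)))"
  shows "summable (\<lambda>n. u (n + l) * X n)"
    and "(norm (T f + s *\<^sub>C T (T f)))\<^sup>2 =
      (\<Sum>n. (u n + (cmod s)\<^sup>2 * (u n * u (n + l))) * (cmod (coord f n))\<^sup>2 + u (n + l) * X n)"
proof -
  define b where "b = block_weight \<omega> l"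
  define g where "g = coord (T f)"
  define a1 a2 a3 where "a1 n = u n * (cmod (coord f n))\<^sup>2"
    and "a2 n = u n * ((cmod s)\<^sup>2 * (cmod (g n))\<^sup>2)"
    and "a3 n = u n * (2 * Re (cnj s * coord f n * cnj (g n)))" for n
  have coord_T: "coord (T h) n = (if n < l then 0 else of_real (b (n - l)) * coord h (n - l))" for h n
    unfolding T_def b_def by (rule coord_weighted_shift_funpow[OF \<omega>])
  have F: "(cmod (coord (T f + s *\<^sub>C T (T f)) (n + l)))\<^sup>2 = a1 n + a2 n + a3 n" for n
  proof -
    have "coord (T f + s *\<^sub>C T (T f)) (n + l) = of_real (b n) * (coord f n + s * g n)"
      by (simp add: plus_ell2.rep_eq scaleC.rep_eq coord_T[of _ "n + l"] g_def)
        (simp add: algebra_simps)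
    then have "(cmod (coord (T f + s *\<^sub>C T (T f)) (n + l)))\<^sup>2 = u n * (cmod (coord f n + s * g n))\<^sup>2"
      by (simp add: norm_mult power_mult_distrib u b_def)
    then show ?thesis
      by (simp add: cmod_add_scaled_power2 a1_def a2_def a3_def distrib_left)
  qed
  have sums_a: "summable a1" "summable a2"
    using summable_bounded_times_coord[OF bounded_u, of f 0]
      summable_mult[OF summable_bounded_times_coord[OF bounded_u, of "T f" 0], of "(cmod s)\<^sup>2"]
    by (simp_all add: a1_def[abs_def] a2_def[abs_def] g_def mult.left_commute)
  have "summable (\<lambda>n. (cmod (coord (T f + s *\<^sub>C T (T f)) (n + l)))\<^sup>2)"
    by (intro summable_iff_shift[THEN iffD2] summable_coord)
  then have "summable (\<lambda>n. a1 n + a2 n + a3 n)" by (simp add: F)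
  then have "summable (\<lambda>n. (a1 n + a2 n + a3 n) - (a1 n + a2 n))"
    by (rule summable_diff[OF _ summable_add[OF sums_a]])
  then have sum_a3: "summable a3"
    by (rule back_subst[of summable]) (simp add: fun_eq_iff)
  have a2_shift: "a2 (n + l) = (cmod s)\<^sup>2 * (u n * u (n + l)) * (cmod (coord f n))\<^sup>2" for n
    by (simp add: a2_def g_def coord_T norm_mult power_mult_distrib u b_def)
  have a3_shift: "a3 (n + l) = u (n + l) * X n" for n
    by (simp add: a3_def X_def g_def coord_T b_def algebra_simps)
  show X: "summable (\<lambda>n. u (n + l) * X n)"
    using summable_iff_shift[THEN iffD2, OF sum_a3, of l] by (simp add: a3_shift)
  have "(norm (T f + s *\<^sub>C T (T f)))\<^sup>2 = (\<Sum>n. a1 n + a2 n + a3 n)"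
    unfolding norm_ell2_power2
    by (subst suminf_shift_of_zeros[OF summable_coord, of l])
       (simp_all add: F, simp add: plus_ell2.rep_eq scaleC.rep_eq coord_T)
  also have "\<dots> = suminf a1 + suminf a2 + suminf a3"
    using sums_a sum_a3 by (simp add: suminf_add summable_add)
  also have "suminf a2 = (\<Sum>n. a2 (n + l))"
    by (rule suminf_shift_of_zeros[OF sums_a(2)]) (simp add: a2_def g_def coord_T)
  also have "suminf a3 = (\<Sum>n. a3 (n + l))"
    by (rule suminf_shift_of_zeros[OF sum_a3]) (simp add: a3_def g_def coord_T)
  also have "suminf a1 + (\<Sum>n. a2 (n + l)) + (\<Sum>n. a3 (n + l))
      = (\<Sum>n. a1 n + a2 (n + l) + a3 (n + l))"
    using sums_a sum_a3 by (simp add: suminf_add summable_add summable_iff_shift)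
  also have "\<dots> = (\<Sum>n. (u n + (cmod s)\<^sup>2 * (u n * u (n + l))) * (cmod (coord f n))\<^sup>2
      + u (n + l) * X n)"
    by (simp add: a2_shift a3_shift a1_def distrib_right)
  finally show "(norm (T f + s *\<^sub>C T (T f)))\<^sup>2 = \<dots>" .
qed

text \<open>The same computation for the adjoint.  The sum starts at \<open>l\<close> here, which is encoded by the factor
  \<open>lag l u\<close>, and it is the term \<open>|g\<^sub>n|\<^sup>2\<close> with \<open>g = T\<^sup>* f\<close> whose index is shifted.\<close>
lemma norm_power2_adjoint_combination:
  fixes f :: ell2 and s :: complex
  defines "S \<equiv> backward_shift \<omega> ^^ l"
  defines "X \<equiv> \<lambda>n. 2 * Re (s * of_real (block_weight \<omega> l n) * coord f n * cnj (coord f (n + l)))"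
  shows "summable (\<lambda>n. lag l u n * X n)"
    and "(norm (S f + cnj s *\<^sub>C S (S f)))\<^sup>2 =
      (\<Sum>n. (lag l u n + (cmod s)\<^sup>2 * (lag l u n * lag (2 * l) u n)) * (cmod (coord f n))\<^sup>2
        + lag l u n * X n)"
proof -
  define b where "b = block_weight \<omega> l"
  define g where "g = coord (S f)"
  define a1 a2 a3 where "a1 n = lag l u n * (cmod (coord f n))\<^sup>2"
    and "a2 n = lag l u n * ((cmod s)\<^sup>2 * (cmod (g n))\<^sup>2)"
    and "a3 n = lag l u n * X n" for n
  define d2 where "d2 n = (cmod s)\<^sup>2 * (lag l u n * lag (2 * l) u n) * (cmod (coord f n))\<^sup>2" for n
  have coord_S: "coord (S h) n = of_real (b n) * coord h (n + l)" for h n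
    unfolding S_def b_def by (rule coord_backward_shift_funpow[OF \<omega>])
  have lag_bounded: "bounded (range (lag l u))"
    by (rule bounded_range_lag[OF bounded_u])
  have F: "(cmod (coord (S f + cnj s *\<^sub>C S (S f)) n))\<^sup>2 = a1 (n + l) + a2 (n + l) + a3 (n + l)" for n
  proof -
    have "coord (S f + cnj s *\<^sub>C S (S f)) n
        = of_real (b n) * (coord f (n + l) + cnj s * g (n + l))"
      by (simp add: plus_ell2.rep_eq scaleC.rep_eq coord_S[of _ n] g_def)
        (simp add: algebra_simps)
    then have "(cmod (coord (S f + cnj s *\<^sub>C S (S f)) n))\<^sup>2
        = u n * (cmod (coord f (n + l) + cnj s * g (n + l)))\<^sup>2"
      by (simp add: norm_mult power_mult_distrib u b_def)
    moreover have "2 * Re (s * coord f (n + l) * cnj (g (n + l))) = X (n + l)"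
      by (simp add: X_def g_def coord_S b_def algebra_simps)
    ultimately show ?thesis
      unfolding cmod_add_scaled_power2 complex_cnj_cnj complex_mod_cnj
      by (simp only: a1_def a2_def a3_def) (simp add: lag_def distrib_left)
  qed
  have sums_a: "summable a1" "summable a2"
    using summable_bounded_times_coord[OF lag_bounded, of f 0]
      summable_mult[OF summable_bounded_times_coord[OF lag_bounded, of "S f" 0], of "(cmod s)\<^sup>2"]
    by (simp_all add: a1_def[abs_def] a2_def[abs_def] g_def mult.left_commute)
  have "summable (\<lambda>n. a1 (n + l) + a2 (n + l) + a3 (n + l))"
    using summable_coord[of "S f + cnj s *\<^sub>C S (S f)"] by (simp add: F)
  then have "summable (\<lambda>n. a1 n + a2 n + a3 n)"
    using summable_iff_shift[of "\<lambda>n. a1 n + a2 n + a3 n" l] by simp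
  then have "summable (\<lambda>n. (a1 n + a2 n + a3 n) - (a1 n + a2 n))"
    by (rule summable_diff[OF _ summable_add[OF sums_a]])
  then have sum_a3: "summable a3"
    by (rule back_subst[of summable]) (simp add: fun_eq_iff)
  then show "summable (\<lambda>n. lag l u n * X n)" by (simp add: a3_def[abs_def])
  have d2: "summable d2"
    using summable_mult[OF summable_bounded_times_coord[OF
        bounded_mult_range[OF lag_bounded bounded_range_lag[OF bounded_u, of "2 * l"]], of f 0],
        of "(cmod s)\<^sup>2"]
    by (simp add: d2_def[abs_def] mult.assoc)
  have d2_shift: "d2 (n + l) = a2 n" for n
    by (simp add: d2_def a2_def g_def coord_S lag_def norm_mult power_mult_distrib u b_def)
  have "suminf a2 = suminf d2"
    by (subst suminf_shift_of_zeros[OF d2, of l]) (simp_all only: d2_shift, simp add: d2_def lag_def)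
  have "(norm (S f + cnj s *\<^sub>C S (S f)))\<^sup>2 = (\<Sum>n. a1 (n + l) + a2 (n + l) + a3 (n + l))"
    unfolding norm_ell2_power2 by (simp add: F)
  also have "\<dots> = (\<Sum>n. a1 n + a2 n + a3 n)"
    by (rule suminf_shift_of_zeros[OF summable_add[OF summable_add[OF sums_a] sum_a3], symmetric])
       (simp add: a1_def a2_def a3_def lag_def)
  also have "\<dots> = suminf a1 + suminf a2 + suminf a3"
    using sums_a sum_a3 by (simp add: suminf_add summable_add)
  also have "\<dots> = (\<Sum>n. a1 n + d2 n + a3 n)"
    unfolding \<open>suminf a2 = suminf d2\<close> using sums_a sum_a3 d2 by (simp add: suminf_add summable_add)
  also have "\<dots> = (\<Sum>n. (lag l u n + (cmod s)\<^sup>2 * (lag l u n * lag (2 * l) u n))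
      * (cmod (coord f n))\<^sup>2 + lag l u n * X n)"
    by (simp add: a1_def d2_def a3_def distrib_right)
  finally show "(norm (S f + cnj s *\<^sub>C S (S f)))\<^sup>2 = \<dots>" .
qed

text \<open>Giving each coupling its two shares bounds the form from below by the sum of the terms
  \<open>c\<^sub>n |f\<^sub>n|\<^sup>2 + e\<^sub>n\<^sub>+\<^sub>l |f\<^sub>n\<^sub>+\<^sub>l|\<^sup>2 + 2 Re (\<dots>)\<close>, each nonnegative by the inequality between the arithmetic
  and the geometric mean, plus the nonnegative shares \<open>e\<^sub>n\<close> with \<open>n < l\<close>.\<close>
lemma quadratically_hyponormal_of_splits:
  assumes splits: "\<And>t. t \<ge> 0 \<Longrightarrow> splits l u t"
  shows "quadratically_hyponormal (weighted_shift \<omega> ^^ l)"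
  unfolding quadratically_hyponormal_def
proof
  fix s :: complex
  define T where "T = weighted_shift \<omega> ^^ l"
  define S where "S = backward_shift \<omega> ^^ l"
  define t where "t = (cmod s)\<^sup>2"
  have T: "bounded_clinear T"
    unfolding T_def by (intro bounded_clinear_funpow bounded_clinear_weighted_shift \<omega>)
  have adj: "is_adjoint T S"
    unfolding T_def S_def by (intro is_adjoint_funpow is_adjoint_weighted_shift \<omega>)
  obtain c e where ce: "\<And>n. 0 \<le> c n" "\<And>n. 0 \<le> e n" "\<And>n. c n + e n \<le> diag_entry l u t n"
    "\<And>n. t * link_entry l u n \<le> c n * e (n + l)"
    using splits[of t] unfolding splits_def t_def by auto
  have "norm (S f + cnj s *\<^sub>C S (S f)) \<le> norm (T f + s *\<^sub>C T (T f))" for f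
  proof (rule power2_le_imp_le)
    define X where
      "X n = 2 * Re (s * of_real (block_weight \<omega> l n) * coord f n * cnj (coord f (n + l)))" for n
    define p where "p n = (cmod (coord f n))\<^sup>2" for n
    note N1 = norm_power2_shift_combination[where s = s and f = f, folded X_def T_def t_def p_def]
    note N2 = norm_power2_adjoint_combination[where s = s and f = f, folded X_def S_def t_def p_def]
    have bnd: "bounded (range (\<lambda>n. u n * u (n + l)))"
      "bounded (range (\<lambda>n. lag l u n * lag (2 * l) u n))"
      using bounded_mult_range[OF bounded_u bounded_range_comp[OF bounded_u, of "\<lambda>n. n + l"]]
        bounded_mult_range[OF bounded_range_lag[OF bounded_u] bounded_range_lag[OF bounded_u]]
      by simp_all
    have s1: "summable (\<lambda>n. (u n + t * (u n * u (n + l))) * p n)"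
      and s2: "summable (\<lambda>n. (lag l u n + t * (lag l u n * lag (2 * l) u n)) * p n)"
      using summable_add[OF summable_bounded_times_coord[OF bounded_u, of f 0]
          summable_mult[OF summable_bounded_times_coord[OF bnd(1), of f 0], of t]]
        summable_add[OF summable_bounded_times_coord[OF bounded_range_lag[OF bounded_u], of l f 0]
          summable_mult[OF summable_bounded_times_coord[OF bnd(2), of f 0], of t]]
      by (simp_all add: p_def algebra_simps)
    define d where "d n = u (n + l) - lag l u n" for n
    have diff: "(norm (T f + s *\<^sub>C T (T f)))\<^sup>2 - (norm (S f + cnj s *\<^sub>C S (S f)))\<^sup>2
        = (\<Sum>n. diag_entry l u t n * p n + d n * X n)"
      unfolding N1(2) N2(2)
      by (subst suminf_diff[OF summable_add[OF s1 N1(1)] summable_add[OF s2 N2(1)]])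
         (simp add: diag_entry_def d_def algebra_simps)
    have sq: "summable (\<lambda>n. diag_entry l u t n * p n)"
      using summable_diff[OF s1 s2] by (simp add: diag_entry_def algebra_simps)
    have dX: "summable (\<lambda>n. d n * X n)"
      using summable_diff[OF N1(1) N2(1)] by (simp add: d_def algebra_simps)
    have p: "0 \<le> p n" for n by (simp add: p_def)
    have le: "c n * p n + e n * p n \<le> diag_entry l u t n * p n" for n
      using mult_right_mono[OF ce(3) p, of n n] by (simp add: distrib_right)
    have cp: "summable (\<lambda>n. c n * p n)" and ep: "summable (\<lambda>n. e n * p n)"
      using ce(1,2) p le
      by (auto intro!: summable_comparison_test'[OF sq, of 0] intro: order_trans[OF _ le]
          simp: abs_mult)
    have cross: "\<bar>d n * X n\<bar> \<le> c n * p n + e (n + l) * p (n + l)" for n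
    proof (rule abs_le_square_iff[THEN iffD2, of _ "c n * p n + e (n + l) * p (n + l)", 
          THEN order_trans])
      define z where "z = s * of_real (block_weight \<omega> l n) * coord f n * cnj (coord f (n + l))"
      have "(Re z)\<^sup>2 \<le> (cmod z)\<^sup>2"
        using abs_Re_le_cmod[of z] by (simp add: abs_le_square_iff[symmetric])
      also have "(cmod z)\<^sup>2 = t * u n * (p n * p (n + l))"
        by (simp add: z_def norm_mult power_mult_distrib t_def u p_def)
      finally have "(d n)\<^sup>2 * (4 * (Re z)\<^sup>2) \<le> (d n)\<^sup>2 * (4 * (t * u n * (p n * p (n + l))))"
        by (intro mult_left_mono) auto
      also have "\<dots> = 4 * (t * link_entry l u n) * (p n * p (n + l))"
        by (simp add: link_entry_def d_def)
      also have "\<dots> \<le> 4 * (c n * e (n + l)) * (p n * p (n + l))"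
        using ce(4)[of n] p by (intro mult_right_mono) auto
      also have "\<dots> \<le> (c n * p n + e (n + l) * p (n + l))\<^sup>2"
        using zero_le_power2[of "c n * p n - e (n + l) * p (n + l)"]
        by (simp add: power2_eq_square algebra_simps)
      also have "(d n)\<^sup>2 * (4 * (Re z)\<^sup>2) = (d n * X n)\<^sup>2"
        unfolding X_def z_def[symmetric] by (simp add: power_mult_distrib)
      finally show "(d n * X n)\<^sup>2 \<le> (c n * p n + e (n + l) * p (n + l))\<^sup>2" .
    qed (use ce p in simp)
    have "(\<Sum>n. e (n + l) * p (n + l)) \<le> (\<Sum>n. e n * p n)"
      using suminf_split_initial_segment[OF ep, of l] ce(2) p by (simp add: sum_nonneg)
    moreover have e_shift: "summable (\<lambda>n. e (n + l) * p (n + l))"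
      using summable_iff_shift[THEN iffD2, OF ep, of l] by simp
    have "0 \<le> (\<Sum>n. (c n * p n + e (n + l) * p (n + l)) + d n * X n)"
      using cross by (intro suminf_nonneg summable_add cp e_shift dX) (smt (verit))
    then have "0 \<le> (\<Sum>n. c n * p n) + (\<Sum>n. e (n + l) * p (n + l)) + (\<Sum>n. d n * X n)"
      using cp e_shift dX by (simp add: suminf_add summable_add)
    moreover have "(\<Sum>n. c n * p n) + (\<Sum>n. e n * p n) \<le> (\<Sum>n. diag_entry l u t n * p n)"
      unfolding suminf_add[OF cp ep] by (intro suminf_le le summable_add cp ep sq)
    ultimately have "0 \<le> (\<Sum>n. diag_entry l u t n * p n + d n * X n)"
      unfolding suminf_add[OF sq dX, symmetric] by linarith
    then show "(norm (S f + cnj s *\<^sub>C S (S f)))\<^sup>2 \<le> (norm (T f + s *\<^sub>C T (T f)))\<^sup>2"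
      using diff by linarith
  qed simp
  moreover have "bounded_clinear (\<lambda>f. T f + s *\<^sub>C T (T f))"
    "is_adjoint (\<lambda>f. T f + s *\<^sub>C T (T f)) (\<lambda>f. S f + cnj s *\<^sub>C S (S f))"
    using bounded_clinear_add_scaleC[OF T bounded_clinear_funpow[OF T, of 2]]
      is_adjoint_add_scaleC[OF adj is_adjoint_funpow[OF adj, of 2]]
    by (simp_all add: numeral_2_eq_2)
  ultimately show "hyponormal (\<lambda>f. (weighted_shift \<omega> ^^ l) f
      + s *\<^sub>C ((weighted_shift \<omega> ^^ l) ^^ 2) f)"
    by (simp add: hyponormal_iff_norm_le numeral_2_eq_2 flip: T_def)
qed

text \<open>Hyponormality of \<open>T\<close> itself (the case \<open>s = 0\<close>), tested on \<open>e\<^sub>l\<close>.\<close>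
lemma quadratically_hyponormal_imp_weight_le:
  assumes "quadratically_hyponormal (weighted_shift \<omega> ^^ l)"
  shows "u 0 \<le> u l"
proof -
  define T where "T = weighted_shift \<omega> ^^ l"
  define S where "S = backward_shift \<omega> ^^ l"
  have "hyponormal (\<lambda>f. T f + 0 *\<^sub>C (T ^^ 2) f)"
    using assms unfolding quadratically_hyponormal_def T_def by blast
  then have "hyponormal T"
    by (simp add: scaleC_zero_left)
  moreover have "bounded_clinear T" "is_adjoint T S"
    unfolding T_def S_def
    by (intro bounded_clinear_funpow bounded_clinear_weighted_shift
        is_adjoint_funpow is_adjoint_weighted_shift \<omega>)+
  ultimately have le: "norm (S (ebasis l)) \<le> norm (T (ebasis l))"
    by (simp add: hyponormal_iff_norm_le)
  have "S (ebasis l) = of_real (block_weight \<omega> l 0) *\<^sub>C ebasis 0"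
    unfolding S_def
    by (rule ell2_eqI) (simp add: coord_backward_shift_funpow[OF \<omega>] ebasis.rep_eq scaleC.rep_eq)
  moreover have "T (ebasis l) = of_real (block_weight \<omega> l l) *\<^sub>C ebasis (l + l)"
    unfolding T_def
    by (rule ell2_eqI)
       (auto simp: coord_weighted_shift_funpow[OF \<omega>] ebasis.rep_eq scaleC.rep_eq)
  moreover have "norm (ebasis k) = 1" for k
  proof -
    have "(\<Sum>n. (cmod (coord (ebasis k) n))\<^sup>2) = 1"
      by (subst suminf_finite[of "{k}"]) (simp_all add: ebasis.rep_eq)
    then show ?thesis by (simp add: norm_ell2_eq)
  qed
  ultimately have "\<bar>block_weight \<omega> l 0\<bar> \<le> \<bar>block_weight \<omega> l l\<bar>"
    using le by (simp add: norm_scaleC)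
  then show ?thesis by (simp add: u abs_le_square_iff)
qed

end

section \<open>Shifts of Bergman type\<close>

text \<open>Here \<open>c = A\<close> and \<open>e = t B\<close>.  The coupling condition \<open>w\<^sub>k \<le> A\<^sub>k B\<^sub>k\<^sub>+\<^sub>1\<close> amounts to
  \<open>(m + 1) (m + 3) \<le> (m + 2)\<^sup>2\<close> when \<open>k > 0\<close>, and to \<open>U\<^sub>1 \<le> U\<^sub>2\<close> when \<open>k = 0\<close>.\<close>
lemma splits_bergman_type:
  assumes b: "b > 0" and t: "t \<ge> 0"
  shows "splits 1 (\<lambda>k. (real k + b) / (real k + 1 + b)) t"
proof -
  define U where "U = (\<lambda>k. (real k + b) / (real k + 1 + b))"
  have U_mono: "U k \<le> U (Suc k)" for k
    using b by (simp add: U_def divide_simps) (simp add: algebra_simps)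
  have U_pos: "0 < U k" for k
    using b by (simp add: U_def)
  have lag_U: "0 \<le> lag j U k" "lag j U k \<le> U k" for j k
    using U_pos lift_Suc_mono_le[of U, OF U_mono] by (auto simp: lag_def less_imp_le)
  have e_nonneg: "lag 1 U k * lag 2 U k \<le> U k * U (k + 1)" for k
    using lag_U U_pos order_trans[OF lag_U(2) U_mono]
    by (intro mult_mono) (auto intro: less_imp_le)
  have link: "link_entry 1 U k \<le>
      (U k - lag 1 U k) * (U (k + 1) * U (k + 2) - lag 1 U (k + 1) * lag 2 U (k + 1))" for k
  proof (cases k)
    case 0
    have "U 0 * (U 1 * U 1) \<le> U 0 * (U 1 * U 2)"
      using U_mono[of 1] U_pos by (intro mult_left_mono) (auto simp: less_imp_le numeral_2_eq_2)
    with 0 show ?thesis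
      by (simp add: link_entry_def lag_def power2_eq_square numeral_2_eq_2)
  next
    case (Suc j)
    define m where "m = real j + 1 + b"
    have m: "m > 1" using b by (simp add: m_def)
    have U_m: "U j = (m - 1) / m" "U (Suc j) = m / (m + 1)" "U (Suc (Suc j)) = (m + 1) / (m + 2)"
      "U (Suc (Suc (Suc j))) = (m + 2) / (m + 3)"
      by (simp_all add: U_def m_def algebra_simps)
    have "m / (m + 1) * ((m + 1) / (m + 2) - (m - 1) / m)\<^sup>2 = 4 / (m * (m + 1) * (m + 2)\<^sup>2)"
      using m by (simp add: divide_simps) algebra
    also have "\<dots> \<le> 4 / (m * (m + 1)\<^sup>2 * (m + 3))"
    proof (rule divide_left_mono)
      have "m * (m + 1) * ((m + 1) * (m + 3)) \<le> m * (m + 1) * (m + 2)\<^sup>2"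
        using m by (intro mult_left_mono) (simp_all add: power2_eq_square algebra_simps)
      then show "m * (m + 1)\<^sup>2 * (m + 3) \<le> m * (m + 1) * (m + 2)\<^sup>2"
        by (simp add: power2_eq_square algebra_simps)
    qed (use m in auto)
    also have "\<dots> = (m / (m + 1) - (m - 1) / m) *
        ((m + 1) / (m + 2) * ((m + 2) / (m + 3)) - m / (m + 1) * ((m - 1) / m))"
      using m by (simp add: divide_simps) algebra
    finally show ?thesis
      using Suc by (simp add: link_entry_def lag_def U_m numeral_2_eq_2)
  qed
  show ?thesis
    unfolding splits_def U_def[symmetric]
  proof (intro exI allI conjI)
    fix k
    show "0 \<le> U k - lag 1 U k" using lag_U by simp
    show "0 \<le> t * (U k * U (k + 1) - lag 1 U k * lag 2 U k)" using e_nonneg t by simp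
    show "U k - lag 1 U k + t * (U k * U (k + 1) - lag 1 U k * lag 2 U k) \<le> diag_entry 1 U t k"
      by (simp add: diag_entry_def)
    show "t * link_entry 1 U k \<le> (U k - lag 1 U k) *
        (t * (U (k + 1) * U (k + 1 + 1) - lag 1 U (k + 1) * lag 2 U (k + 1)))"
      using mult_left_mono[OF link t, of k] by (simp add: numeral_2_eq_2 mult.left_commute)
  qed
qed

section \<open>Shifts of Bergman type with a perturbed first weight\<close>

text \<open>Eliminating rows \<open>0\<close> and \<open>1\<close> leaves row \<open>2\<close> with the Schur complement
  \<open>q\<^sub>2 - t w\<^sub>1 q\<^sub>0 / (q\<^sub>0 q\<^sub>1 - t w\<^sub>0)\<close>, and any \<open>\<rho>\<close> below it is available for the coupling of row \<open>2\<close>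
  with row \<open>3\<close>.\<close>
lemma splits_of_leading_block:
  fixes U q w c e :: "nat \<Rightarrow> real" and t :: real
  defines "q \<equiv> diag_entry 1 U t" and "w \<equiv> link_entry 1 U"
  assumes t: "t \<ge> 0" and w: "0 \<le> w 0" "0 \<le> w 1"
    and q0: "0 < q 0" and minor: "t * w 0 < q 0 * q 1"
    and head: "t * w 1 * q 0 \<le> (q 2 - \<rho>) * (q 0 * q 1 - t * w 0)"
    and \<rho>: "0 \<le> \<rho>" "t * w 2 \<le> \<rho> * e 3"
    and tail: "\<And>k. k \<ge> 3 \<Longrightarrow>
      0 \<le> c k \<and> 0 \<le> e k \<and> c k + e k \<le> q k \<and> t * w k \<le> c k * e (Suc k)"
  shows "splits 1 U t"
proof -
  define e1 where "e1 = t * w 0 / q 0"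
  define c1 where "c1 = q 1 - e1"
  define e2 where "e2 = t * w 1 / c1"
  have c1: "0 < c1" "q 0 * c1 = q 0 * q 1 - t * w 0"
    using q0 minor by (simp_all add: c1_def e1_def field_simps)
  have "q 0 * (t * w 1) \<le> q 0 * ((q 2 - \<rho>) * c1)"
    using head unfolding c1(2)[symmetric] by (simp add: ac_simps)
  then have "t * w 1 \<le> (q 2 - \<rho>) * c1"
    using q0 by simp
  then have "e2 \<le> q 2 - \<rho>"
    using c1(1) by (simp add: e2_def pos_divide_le_eq)
  then have e2: "\<rho> + e2 \<le> q 2" by simp
  have pos: "0 \<le> e1" "0 \<le> e2"
    using t w q0 c1 by (simp_all add: e1_def e2_def)
  define c' where "c' k = (if k = 0 then q 0 else if k = 1 then c1 else if k = 2 then \<rho> else c k)" for k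
  define e' where "e' k = (if k = 0 then 0 else if k = 1 then e1 else if k = 2 then e2 else e k)" for k
  have "0 \<le> c' k \<and> 0 \<le> e' k \<and> c' k + e' k \<le> q k \<and> t * w k \<le> c' k * e' (k + 1)" for k
  proof -
    consider "k = 0" | "k = 1" | "k = 2" | "k \<ge> 3" by linarith
    then show ?thesis
    proof cases
      case 1
      then show ?thesis using q0 by (simp add: c'_def e'_def e1_def)
    next
      case 2
      then show ?thesis using c1(1) pos by (simp add: c'_def e'_def e2_def c1_def)
    next
      case 3
      then show ?thesis using \<rho> pos e2 by (simp add: c'_def e'_def)
    next
      case 4
      then show ?thesis using tail[of k] by (simp add: c'_def e'_def)
    qed
  qed
  then show ?thesis
    unfolding splits_def q_def w_def by blast
qed

text \<open>The defect of the Schur complement inequality for the splitting \<open>c = t B\<close>, \<open>e = A\<close> of the tail,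
  divided by \<open>y\<close>.  The quantity \<open>\<rho>\<close> is \<open>t B\<^sub>2\<close> for the unperturbed weights, because \<open>t w\<^sub>2 = t B\<^sub>2 A\<^sub>3\<close>.\<close>
lemma leading_minor_small_parameter:
  fixes a y t :: real
  assumes a: "0 < a"
    and u: "u1 = (1 + a) / (2 + a)" "u2 = (2 + a) / (3 + a)" "u3 = (3 + a) / (4 + a)"
    and \<rho>: "\<rho> = 4 * t / ((2 + a) * (4 + a))"
  shows "((u2 - u1) + t * (u2 * u3 - u1 * y) - \<rho>) * ((u1 - y) + t * u1 * (u2 - y) + t^2 * u1^2 * u2)
      - t * u1 * (u2 - y)^2 * (1 + t * u1)
    = ((1 - 2 * t) * ((1 + a) - (2 + a) * y) + t^2 * (1 + a) * (2 * y - 1)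
    - t^3 * (1 + a)^2 * ((1 + a) * y - a)) / ((2 + a)^2 * (3 + a))"
  unfolding u \<rho> using a by (simp add: divide_simps) algebra

text \<open>The same defect for the splitting \<open>c\<^sub>k = A\<^sub>k (1 - 1 / (m + 2)\<^sup>2)\<close> of the tail.  This is \<open>w\<^sub>k / B\<^sub>k\<^sub>+\<^sub>1\<close>,
  the least share of row \<open>k\<close> for which \<open>t B\<^sub>k\<^sub>+\<^sub>1\<close> suffices in the next row; the rest of \<open>A\<^sub>k\<close> is added to
  \<open>e\<^sub>k\<close>.  Row \<open>2\<close> must then supply \<open>\<rho> = t w\<^sub>2 / e\<^sub>3\<close>.\<close>
lemma leading_minor_large_parameter:
  fixes a y t :: real
  assumes a: "0 < a" "0 \<le> t"
    and u: "u1 = (1 + a) / (2 + a)" "u2 = (2 + a) / (3 + a)" "u3 = (3 + a) / (4 + a)"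
    and M: "M = 1 + 4 * t * (4 + a) * (5 + a)"
    and \<rho>: "\<rho> = 4 * t * (5 + a)^2 / ((2 + a) * (4 + a) * M)"
  shows "((u2 - u1) + t * (u2 * u3 - u1 * y) - \<rho>) * ((u1 - y) + t * u1 * (u2 - y) + t^2 * u1^2 * u2)
      - t * u1 * (u2 - y)^2 * (1 + t * u1)
    = ((1 + 6 * t) * ((1 + a) - (2 + a) * y)
    + t^2 * (31 + 55 * a + 28 * a^2 + 4 * a^3 - (86 + 82 * a + 32 * a^2 + 4 * a^3) * y)
    + t^3 * (56 + 105 * a + 58 * a^2 + 9 * a^3 - (81 + 139 * a + 67 * a^2 + 9 * a^3) * y)
    + t^4 * (80 + 256 * a + 308 * a^2 + 172 * a^3 + 44 * a^4 + 4 * a^5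
       - (80 + 276 * a + 352 * a^2 + 200 * a^3 + 48 * a^4 + 4 * a^5) * y)) / ((2 + a)^2 * (3 + a) * M)"
proof -
  have "M > 0" using a by (simp add: M add_pos_nonneg)
  then have "M \<noteq> 0" by simp
  then show ?thesis
    unfolding u \<rho> using a by (simp add: divide_simps) (use M in algebra)
qed

text \<open>Hypothesis \<open>c1\<close> says that the numerator in \<open>leading_minor_small_parameter\<close>, here called \<open>G\<close>, is
  nonnegative at \<open>t = 3 / 10\<close>.  For smaller \<open>t\<close> it is compared with \<open>(10 t / 3)\<^sup>2 G (3 / 10)\<close>: the difference has the factor
  \<open>1 - 10 t / 3\<close>, and the cofactor is nonnegative because \<open>y\<close> is at most the next squared weight
  \<open>(1 + a) / (2 + a)\<close> and \<open>a\<close> is at most \<open>1 / 2\<close>.\<close>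
lemma small_parameter_numerator_nonneg:
  fixes a y t :: real
  assumes a: "0 < a" "a \<le> 1 / 2" and y: "0 < y" "y * (2 + a) \<le> 1 + a"
    and c1: "y * (647 + 301 * a + 81 * a^2 + 27 * a^3) \<le> 310 + 337 * a + 54 * a^2 + 27 * a^3"
    and t: "0 \<le> t" "t \<le> 3 / 10"
  shows "0 \<le> (1 - 2 * t) * ((1 + a) - (2 + a) * y) + t^2 * (1 + a) * (2 * y - 1)
    - t^3 * (1 + a)^2 * ((1 + a) * y - a)"
proof -
  define G where "G t = (1 - 2 * t) * ((1 + a) - (2 + a) * y) + t^2 * (1 + a) * (2 * y - 1)
    - t^3 * (1 + a)^2 * ((1 + a) * y - a)" for t
  define h where "h = (1 + a) - (2 + a) * y"
  have h: "0 \<le> h" using y by (simp add: h_def algebra_simps)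
  have G3: "0 \<le> G (3 / 10)"
  proof -
    have "1000 * G (3 / 10) = 310 + 337 * a + 54 * a^2 + 27 * a^3
        - y * (647 + 301 * a + 81 * a^2 + 27 * a^3)"
      unfolding G_def by algebra
    with c1 show ?thesis by linarith
  qed
  have "0 \<le> h * (1 + 4 / 3 * t) + 3 / 10 * t^2 * ((1 + a)^2 * ((1 + a) * y - a))"
  proof (cases "a \<le> (1 + a) * y")
    case True
    then show ?thesis using h t a by (intro add_nonneg_nonneg mult_nonneg_nonneg) auto
  next
    case False
    then have ya: "y + a * y < a" by (simp add: algebra_simps)
    have "0 < a * y" using a y by simp
    with ya have "y \<le> 1" using a by linarith
    then have "a * (1 - y) \<le> 1 / 2 * (1 - y)" using a by (intro mult_right_mono) auto
    with ya have y3: "y \<le> 1 / 3" by (simp add: algebra_simps)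
    have "a * y \<le> a * (1 / 3)" using a y3 by (intro mult_left_mono) auto
    moreover have "h = 1 + a - 2 * y - a * y" by (simp add: h_def algebra_simps)
    ultimately have h3: "1 / 3 \<le> h" using a y3 by linarith
    define z where "z = a - (1 + a) * y"
    have "z = a - y - a * y" by (simp add: z_def algebra_simps)
    then have "0 \<le> z" "z \<le> 1 / 2"
      using ya a y \<open>0 < a * y\<close> by linarith+
    then have "3 / 10 * t^2 * ((1 + a)^2 * z) \<le> 3 / 10 * (3 / 10)^2 * ((3 / 2)^2 * (1 / 2))"
      using a t by (intro mult_mono power_mono mult_nonneg_nonneg) auto
    also have "\<dots> \<le> 1 / 3" by (simp add: power2_eq_square)
    finally have "3 / 10 * t^2 * ((1 + a)^2 * z) \<le> 1 / 3" .
    moreover have "h \<le> h * (1 + 4 / 3 * t)" using h t by (simp add: algebra_simps)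
    moreover have "3 / 10 * t^2 * ((1 + a)^2 * ((1 + a) * y - a)) = - (3 / 10 * t^2 * ((1 + a)^2 * z))"
      by (simp add: z_def algebra_simps)
    ultimately show ?thesis using h3 by linarith
  qed
  moreover have "G t = (10 / 3 * t)^2 * G (3 / 10)
      + (1 - 10 / 3 * t) * (h * (1 + 4 / 3 * t) + 3 / 10 * t^2 * ((1 + a)^2 * ((1 + a) * y - a)))"
    unfolding h_def G_def by algebra
  ultimately have "0 \<le> G t" using G3 t by simp
  then show ?thesis by (simp add: G_def)
qed

lemma affine_nonneg_below_ratio:
  fixes y :: real
  assumes "y * d \<le> n" "0 < d" "0 \<le> n1" "n1 * n \<le> n0 * d"
  shows "0 \<le> n0 - n1 * y"
proof -
  have "n1 * (y * d) \<le> n0 * d"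
    using assms by (meson mult_left_mono order_trans)
  then have "0 \<le> (n0 - n1 * y) * d" by (simp add: algebra_simps)
  then show ?thesis using \<open>0 < d\<close> by (simp add: zero_le_mult_iff)
qed

text \<open>In powers of \<open>p = 10 t - 3\<close> all coefficients of this numerator from
  \<open>leading_minor_large_parameter\<close> are nonnegative.  They decrease in
  \<open>y\<close>, so it is enough to check them at an upper bound for \<open>y\<close>: hypothesis \<open>c1\<close> for the constant
  coefficient, which is the tight one, and \<open>y \<le> (1 + a) / (2 + a)\<close> for the others.\<close>
lemma large_parameter_numerator_nonneg:
  fixes a y t :: real
  assumes a: "0 < a" "a \<le> 1 / 2" and y: "y * (2 + a) \<le> 1 + a"
    and c1: "y * (647 + 301 * a + 81 * a^2 + 27 * a^3) \<le> 310 + 337 * a + 54 * a^2 + 27 * a^3"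
    and t: "3 / 10 \<le> t"
  shows "0 \<le> (1 + 6 * t) * ((1 + a) - (2 + a) * y)
    + t^2 * (31 + 55 * a + 28 * a^2 + 4 * a^3 - (86 + 82 * a + 32 * a^2 + 4 * a^3) * y)
    + t^3 * (56 + 105 * a + 58 * a^2 + 9 * a^3 - (81 + 139 * a + 67 * a^2 + 9 * a^3) * y)
    + t^4 * (80 + 256 * a + 308 * a^2 + 172 * a^3 + 44 * a^4 + 4 * a^5
       - (80 + 276 * a + 352 * a^2 + 200 * a^3 + 48 * a^4 + 4 * a^5) * y)" (is "0 \<le> ?H")
proof -
  define p where "p = 10 * t - 3"
  have p: "0 \<le> p" using t by (simp add: p_def)
  have d: "0 < 2 + a" "0 < 647 + 301 * a + 81 * a^2 + 27 * a^3"
    using a by (auto intro!: add_pos_nonneg)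
  have k0: "0 \<le> (77500 + 126586 * a + 65808 * a^2 + 19962 * a^3 + 3564 * a^4 + 324 * a^5)
      - (161750 + 161686 * a + 75402 * a^2 + 22230 * a^3 + 3888 * a^4 + 324 * a^5) * y"
  proof (rule affine_nonneg_below_ratio[OF c1 d(2)])
    have "(77500 + 126586 * a + 65808 * a^2 + 19962 * a^3 + 3564 * a^4 + 324 * a^5) * (647 + 301 * a + 81 * a^2 + 27 * a^3)
        - (161750 + 161686 * a + 75402 * a^2 + 22230 * a^3 + 3888 * a^4 + 324 * a^5) * (310 + 337 * a + 54 * a^2 + 27 * a^3)
        = 596232 * a + 360360 * a^2 - 330480 * a^3 - 71280 * a^4 + 29160 * a^5 + 5832 * a^6"
      by algebra
    also have "\<dots> = 596232 * a + a^2 * (360360 - 330480 * a - 71280 * (a * a)) + 29160 * a^5 + 5832 * a^6"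
      by algebra
    also have "\<dots> \<ge> 0"
    proof (intro add_nonneg_nonneg mult_nonneg_nonneg)
      have "a * a \<le> 1 / 2 * (1 / 2)" using a by (intro mult_mono) auto
      then show "0 \<le> 360360 - 330480 * a - 71280 * (a * a)" using a by linarith
    qed (use a in auto)
    finally show "(161750 + 161686 * a + 75402 * a^2 + 22230 * a^3 + 3888 * a^4 + 324 * a^5) * (310 + 337 * a + 54 * a^2 + 27 * a^3)
        \<le> (77500 + 126586 * a + 65808 * a^2 + 19962 * a^3 + 3564 * a^4 + 324 * a^5) * (647 + 301 * a + 81 * a^2 + 27 * a^3)"
      by simp
  qed (use a in \<open>auto intro!: add_nonneg_nonneg\<close>)
  have k1: "0 \<le> (48360 + 94998 * a + 65724 * a^2 + 23406 * a^3 + 4752 * a^4 + 432 * a^5)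
      - (94110 + 122538 * a + 75306 * a^2 + 26430 * a^3 + 5184 * a^4 + 432 * a^5) * y"
  proof (rule affine_nonneg_below_ratio[OF y d(1)])
    have "(48360 + 94998 * a + 65724 * a^2 + 23406 * a^3 + 4752 * a^4 + 432 * a^5) * (2 + a)
        - (94110 + 122538 * a + 75306 * a^2 + 26430 * a^3 + 5184 * a^4 + 432 * a^5) * (1 + a)
        = 2610 + 21708 * a + 28602 * a^2 + 10800 * a^3 + 1296 * a^4"
      by algebra
    also have "\<dots> \<ge> 0" using a by (intro add_nonneg_nonneg) auto
    finally show "(94110 + 122538 * a + 75306 * a^2 + 26430 * a^3 + 5184 * a^4 + 432 * a^5) * (1 + a)
        \<le> (48360 + 94998 * a + 65724 * a^2 + 23406 * a^3 + 4752 * a^4 + 432 * a^5) * (2 + a)"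
      by simp
  qed (use a in \<open>auto intro!: add_nonneg_nonneg\<close>)
  have k2: "0 \<le> (12460 + 28774 * a + 24652 * a^2 + 10498 * a^3 + 2376 * a^4 + 216 * a^5)
      - (20210 + 35614 * a + 28238 * a^2 + 12010 * a^3 + 2592 * a^4 + 216 * a^5) * y"
  proof (rule affine_nonneg_below_ratio[OF y d(1)])
    have "(12460 + 28774 * a + 24652 * a^2 + 10498 * a^3 + 2376 * a^4 + 216 * a^5) * (2 + a)
        - (20210 + 35614 * a + 28238 * a^2 + 12010 * a^3 + 2592 * a^4 + 216 * a^5) * (1 + a)
        = 4710 + 14184 * a + 14226 * a^2 + 5400 * a^3 + 648 * a^4"
      by algebra
    also have "\<dots> \<ge> 0" using a by (intro add_nonneg_nonneg) auto
    finally show "(20210 + 35614 * a + 28238 * a^2 + 12010 * a^3 + 2592 * a^4 + 216 * a^5) * (1 + a)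
        \<le> (12460 + 28774 * a + 24652 * a^2 + 10498 * a^3 + 2376 * a^4 + 216 * a^5) * (2 + a)"
      by simp
  qed (use a in \<open>auto intro!: add_nonneg_nonneg\<close>)
  have k3: "0 \<le> (1520 + 4122 * a + 4276 * a^2 + 2154 * a^3 + 528 * a^4 + 48 * a^5)
      - (1770 + 4702 * a + 4894 * a^2 + 2490 * a^3 + 576 * a^4 + 48 * a^5) * y"
  proof (rule affine_nonneg_below_ratio[OF y d(1)])
    have "(1520 + 4122 * a + 4276 * a^2 + 2154 * a^3 + 528 * a^4 + 48 * a^5) * (2 + a)
        - (1770 + 4702 * a + 4894 * a^2 + 2490 * a^3 + 576 * a^4 + 48 * a^5) * (1 + a)
        = 1270 + 3292 * a + 3078 * a^2 + 1200 * a^3 + 144 * a^4"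
      by algebra
    also have "\<dots> \<ge> 0" using a by (intro add_nonneg_nonneg) auto
    finally show "(1770 + 4702 * a + 4894 * a^2 + 2490 * a^3 + 576 * a^4 + 48 * a^5) * (1 + a)
        \<le> (1520 + 4122 * a + 4276 * a^2 + 2154 * a^3 + 528 * a^4 + 48 * a^5) * (2 + a)"
      by simp
  qed (use a in \<open>auto intro!: add_nonneg_nonneg\<close>)
  have k4: "0 \<le> (80 + 256 * a + 308 * a^2 + 172 * a^3 + 44 * a^4 + 4 * a^5)
      - (80 + 276 * a + 352 * a^2 + 200 * a^3 + 48 * a^4 + 4 * a^5) * y"
  proof (rule affine_nonneg_below_ratio[OF y d(1)])
    have "(80 + 256 * a + 308 * a^2 + 172 * a^3 + 44 * a^4 + 4 * a^5) * (2 + a)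
        - (80 + 276 * a + 352 * a^2 + 200 * a^3 + 48 * a^4 + 4 * a^5) * (1 + a)
        = 80 + 236 * a + 244 * a^2 + 100 * a^3 + 12 * a^4"
      by algebra
    also have "\<dots> \<ge> 0" using a by (intro add_nonneg_nonneg) auto
    finally show "(80 + 276 * a + 352 * a^2 + 200 * a^3 + 48 * a^4 + 4 * a^5) * (1 + a)
        \<le> (80 + 256 * a + 308 * a^2 + 172 * a^3 + 44 * a^4 + 4 * a^5) * (2 + a)"
      by simp
  qed (use a in \<open>auto intro!: add_nonneg_nonneg\<close>)
  have "10000 * ?H = p^0 * ((77500 + 126586 * a + 65808 * a^2 + 19962 * a^3 + 3564 * a^4 + 324 * a^5)
      - (161750 + 161686 * a + 75402 * a^2 + 22230 * a^3 + 3888 * a^4 + 324 * a^5) * y)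
    + p^1 * ((48360 + 94998 * a + 65724 * a^2 + 23406 * a^3 + 4752 * a^4 + 432 * a^5)
      - (94110 + 122538 * a + 75306 * a^2 + 26430 * a^3 + 5184 * a^4 + 432 * a^5) * y)
    + p^2 * ((12460 + 28774 * a + 24652 * a^2 + 10498 * a^3 + 2376 * a^4 + 216 * a^5)
      - (20210 + 35614 * a + 28238 * a^2 + 12010 * a^3 + 2592 * a^4 + 216 * a^5) * y)
    + p^3 * ((1520 + 4122 * a + 4276 * a^2 + 2154 * a^3 + 528 * a^4 + 48 * a^5)
      - (1770 + 4702 * a + 4894 * a^2 + 2490 * a^3 + 576 * a^4 + 48 * a^5) * y)
    + p^4 * ((80 + 256 * a + 308 * a^2 + 172 * a^3 + 44 * a^4 + 4 * a^5)
      - (80 + 276 * a + 352 * a^2 + 200 * a^3 + 48 * a^4 + 4 * a^5) * y)"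
    unfolding p_def by algebra
  also have "\<dots> \<ge> 0"
    using p k0 k1 k2 k3 k4 by (intro add_nonneg_nonneg mult_nonneg_nonneg) auto
  finally show ?thesis by (simp only: zero_le_mult_iff) simp
qed

text \<open>For small \<open>t\<close> the splitting \<open>c = t B\<close> of the tail asks less of row \<open>2\<close>, for large \<open>t\<close> the other
  one does.  At \<open>t = 3 / 10\<close> row \<open>2\<close> can meet either demand.\<close>
lemma splits_perturbed_bergman_type:
  fixes U :: "nat \<Rightarrow> real" and a y t :: real
  assumes a: "0 < a" "a \<le> 1 / 2" and y: "0 < y" "y * (2 + a) \<le> 1 + a"
    and c1: "y * (647 + 301 * a + 81 * a^2 + 27 * a^3) \<le> 310 + 337 * a + 54 * a^2 + 27 * a^3"
    and U0: "U 0 = y" and U: "\<And>k. k \<ge> 1 \<Longrightarrow> U k = (real k + a) / (real k + 1 + a)"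
    and t: "t \<ge> 0"
  shows "splits 1 U t"
proof (cases "t = 0")
  case True
  have "lag 1 U n \<le> U n" for n
  proof -
    consider "n = 0" | "n = 1" | m where "n = Suc (Suc m)" by (metis One_nat_def not0_implies_Suc)
    then show ?thesis
    proof cases
      case 1
      then show ?thesis using y U0 by (simp add: lag_def)
    next
      case 2
      have "y \<le> (1 + a) / (2 + a)" using y a by (simp add: pos_le_divide_eq)
      with 2 show ?thesis using U0 U[of 1] by (simp add: lag_def)
    next
      case 3
      have "(real m + a + 1) / (real m + a + 2) \<le> (real m + a + 2) / (real m + a + 3)"
        using a by (simp add: divide_simps) (simp add: algebra_simps)
      also have "(real m + a + 1) / (real m + a + 2) = U (Suc m)"
        using U[of "Suc m"] by (simp add: algebra_simps)
      also have "(real m + a + 2) / (real m + a + 3) = U (Suc (Suc m))"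
        using U[of "Suc (Suc m)"] by (simp add: algebra_simps)
      finally show ?thesis using 3 by (simp add: lag_def)
    qed
  qed
  then show ?thesis using True splits_zero by blast
next
  case False
  with t have t: "t > 0" by simp
  define q w where "q = diag_entry 1 U t" and "w = link_entry 1 U"
  define u1 u2 u3 where "u1 = (1 + a) / (2 + a)" and "u2 = (2 + a) / (3 + a)" and "u3 = (3 + a) / (4 + a)"
  have U123: "U (Suc 0) = u1" "U 2 = u2" "U 3 = u3"
    using U[of 1] U[of 2] U[of 3] by (simp_all add: u1_def u2_def u3_def)
  have q012: "q 0 = y * (1 + t * u1)" "q 1 = (u1 - y) + t * (u1 * u2)"
    "q 2 = (u2 - u1) + t * (u2 * u3 - u1 * y)"
    and w01: "w 0 = y * u1^2" "w 1 = u1 * (u2 - y)^2"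
    using U123 by (simp_all add: q_def w_def diag_entry_def link_entry_def lag_def U0 numeral_2_eq_2
        numeral_3_eq_3 algebra_simps)
  have u_pos: "0 < u1" "0 < u2" and u_le: "y \<le> u1" "u1 < u2"
    using a y by (simp_all add: u1_def u2_def pos_le_divide_eq divide_strict_right_mono divide_simps)
      (simp add: algebra_simps)
  \<comment> \<open>The leading \<open>2 \<times> 2\<close> minor without its factor \<open>y\<close>.\<close>
  define D where "D = (u1 - y) + t * u1 * (u2 - y) + t^2 * u1^2 * u2"
  have D: "q 0 * q 1 - t * w 0 = y * D"
    unfolding q012 w01 D_def by algebra
  have "0 \<le> (u1 - y) + t * u1 * (u2 - y)"
    using u_pos u_le t by simp
  moreover have "0 < t^2 * u1^2 * u2" using u_pos t by simp
  ultimately have "D > 0" unfolding D_def by linarith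
  then have "0 < y * D" using y by simp
  then have minor: "t * w 0 < q 0 * q 1" using D by linarith
  have q0: "q 0 > 0" using y t u_pos by (simp add: q012 add_pos_pos)
  have head: "t * w 1 * q 0 \<le> (q 2 - \<rho>) * (q 0 * q 1 - t * w 0)"
    if "0 \<le> (q 2 - \<rho>) * D - t * u1 * (u2 - y)^2 * (1 + t * u1)" for \<rho>
  proof -
    have "(q 2 - \<rho>) * (y * D) - t * w 1 * q 0
        = y * ((q 2 - \<rho>) * D - t * u1 * (u2 - y)^2 * (1 + t * u1))"
      unfolding w01 q012(1) by algebra
    also have "\<dots> \<ge> 0" using that y by simp
    finally show ?thesis unfolding D by simp
  qed
  have w_nonneg: "0 \<le> w 0" "0 \<le> w 1"
    unfolding w01 using y u_pos by simp_all
  define m where "m k = real k + a" for k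
  have m: "m k > 0" "m (Suc k) = m k + 1" for k
    using a by (simp_all add: m_def)
  have wk: "w k = 4 / (m k * (m k + 1) * (m k + 2)^2)" if "k \<ge> 2" for k
  proof -
    have "U k = m k / (m k + 1)" "U (k + 1) = (m k + 1) / (m k + 2)" "U (k - 1) = (m k - 1) / m k"
      using that U[of k] U[of "k + 1"] U[of "k - 1"] by (simp_all add: m_def algebra_simps of_nat_diff)
    moreover have "m k / (m k + 1) * ((m k + 1) / (m k + 2) - (m k - 1) / m k)^2
        = 4 / (m k * (m k + 1) * (m k + 2)^2)"
      using m(1)[of k] by (simp add: divide_simps) algebra
    ultimately show ?thesis
      using that by (simp add: w_def link_entry_def lag_def)
  qed
  have qk: "q k = 1 / (m k * (m k + 1)) + t * (4 / (m k * (m k + 2)))" if "k \<ge> 3" for k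
  proof -
    have "U k = m k / (m k + 1)" "U (k + 1) = (m k + 1) / (m k + 2)" "U (k - 1) = (m k - 1) / m k"
      "U (k - 2) = (m k - 2) / (m k - 1)"
      using that U[of k] U[of "k + 1"] U[of "k - 1"] U[of "k - 2"]
      by (simp_all add: m_def algebra_simps of_nat_diff)
    moreover have "m k > 1" using that a by (simp add: m_def)
    then have "m k / (m k + 1) - (m k - 1) / m k = 1 / (m k * (m k + 1))"
      "m k / (m k + 2) - (m k - 2) / m k = 4 / (m k * (m k + 2))"
      "m k / (m k + 1) * ((m k + 1) / (m k + 2)) = m k / (m k + 2)"
      "(m k - 1) / m k * ((m k - 2) / (m k - 1)) = (m k - 2) / m k"
      by (simp_all add: divide_simps) (simp_all add: algebra_simps)
    moreover have "q k = (U k - U (k - 1)) + t * (U k * U (k + 1) - U (k - 1) * U (k - 2))"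
      using that by (simp add: q_def diag_entry_def lag_def)
    ultimately show ?thesis by (simp only:)
  qed
  show ?thesis
  proof (cases "t \<le> 3 / 10")
    case True
    define \<rho> where "\<rho> = 4 * t / ((2 + a) * (4 + a))"
    have "0 \<le> (q 2 - \<rho>) * D - t * u1 * (u2 - y)^2 * (1 + t * u1)"
      unfolding q012(3) D_def leading_minor_small_parameter[OF a(1) u1_def u2_def u3_def \<rho>_def]
      using small_parameter_numerator_nonneg[OF a y c1 _ True] t a by (intro divide_nonneg_nonneg) simp_all
    note head = head[OF this]
    show ?thesis
    proof (rule splits_of_leading_block[where U = U and t = t and \<rho> = \<rho> and c = "\<lambda>k. t * (4 / (m k * (m k + 2)))"
          and e = "\<lambda>k. 1 / (m k * (m k + 1))", folded q_def w_def, OF less_imp_le[OF t] w_nonneg q0 minor head])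
      show "0 \<le> \<rho>" using a t by (simp add: \<rho>_def)
      \<comment> \<open>Equality holds here and in the coupling condition for the tail, as \<open>w\<^sub>k = B\<^sub>k A\<^sub>k\<^sub>+\<^sub>1\<close>.\<close>
      show "t * w 2 \<le> \<rho> * (1 / (m 3 * (m 3 + 1)))"
        using a t wk[of 2] by (simp add: \<rho>_def m_def divide_simps power2_eq_square) (simp add: algebra_simps)
      show "0 \<le> t * (4 / (m k * (m k + 2))) \<and> 0 \<le> 1 / (m k * (m k + 1)) \<and>
          t * (4 / (m k * (m k + 2))) + 1 / (m k * (m k + 1)) \<le> q k \<and>
          t * w k \<le> t * (4 / (m k * (m k + 2))) * (1 / (m (Suc k) * (m (Suc k) + 1)))"
        if "k \<ge> 3" for k
        using that t m[of k] by (simp add: qk wk power2_eq_square ac_simps)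
    qed
  next
    case False
    define M where "M = 1 + 4 * t * (4 + a) * (5 + a)"
    define \<rho> where "\<rho> = 4 * t * (5 + a)^2 / ((2 + a) * (4 + a) * M)"
    have M: "M > 0" using a t by (simp add: M_def add_pos_pos)
    have "0 \<le> (q 2 - \<rho>) * D - t * u1 * (u2 - y)^2 * (1 + t * u1)"
      unfolding q012(3) D_def leading_minor_large_parameter[OF a(1) less_imp_le[OF t] u1_def u2_def u3_def M_def \<rho>_def]
      using large_parameter_numerator_nonneg[OF a y(2) c1, of t] False M a by (intro divide_nonneg_nonneg) simp_all
    note head = head[OF this]
    define c where "c k = (m k + 3) / (m k * (m k + 2)^2)" for k
    define e where "e k = 1 / (m k * (m k + 1) * (m k + 2)^2) + t * (4 / (m k * (m k + 2)))" for k
    have c_e: "c k \<ge> 0" "e k \<ge> 0" for k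
      using m(1)[of k] t by (simp_all add: c_def e_def)
    show ?thesis
    proof (rule splits_of_leading_block[where U = U and t = t and \<rho> = \<rho> and c = c and e = e,
          folded q_def w_def, OF less_imp_le[OF t] w_nonneg q0 minor head])
      show "0 \<le> \<rho>" using a t M by (simp add: \<rho>_def)
      have "e 3 = M / ((3 + a) * (4 + a) * (5 + a)^2)"
        unfolding M_def e_def m_def using a by (simp add: divide_simps) algebra
      then have "\<rho> * e 3 = 4 * t / ((2 + a) * (3 + a) * (4 + a)^2)"
        using a M by (simp add: \<rho>_def power2_eq_square)
      then show "t * w 2 \<le> \<rho> * e 3"
        using wk[of 2] by (simp add: m_def add.commute mult.commute[of t])
      show "0 \<le> c k \<and> 0 \<le> e k \<and> c k + e k \<le> q k \<and> t * w k \<le> c k * e (Suc k)"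
        if "k \<ge> 3" for k
      proof (intro conjI c_e)
        have "c k + 1 / (m k * (m k + 1) * (m k + 2)^2) = 1 / (m k * (m k + 1))"
          using m(1)[of k] by (simp add: c_def divide_simps) algebra
        then show "c k + e k \<le> q k" using that by (simp add: e_def qk)
        have "t * w k = c k * (t * (4 / (m (Suc k) * (m (Suc k) + 2))))"
          using m[of k] that by (simp add: wk c_def divide_simps)
        also have "\<dots> \<le> c k * e (Suc k)"
          using c_e(1) m[of k] by (intro mult_left_mono) (simp_all add: e_def)
        finally show "t * w k \<le> c k * e (Suc k)" .
      qed
    qed
  qed
qed

section \<open>Back-step extensions of the Bergman shift\<close>

text \<open>The squared weights of the power are telescoping products.  The perturbed weight enters only the
  product that starts at \<open>0\<close>, where it replaces \<open>1 / 2\<close>.\<close>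
lemma bergman_backstep_power:
  fixes x :: real and \<alpha> :: "nat \<Rightarrow> real" and l :: nat
  assumes alpha: "\<And>n. \<alpha> n = sqrt ((real n + 2) / (real n + 3))" and x: "x > 0" and l: "l > 0"
  shows "bounded (range (back_step (sqrt x) \<alpha>))"
    and "(block_weight (back_step (sqrt x) \<alpha>) l n)\<^sup>2
      = (if n = 0 then 2 * x / (real l + 1) else (real n + 1) / (real n + real l + 1))"
proof -
  define \<omega> where "\<omega> = back_step (sqrt x) \<alpha>"
  have \<omega>: "\<omega> 0 = sqrt x" "\<omega> (Suc k) = sqrt ((real k + 2) / (real k + 3))" for k
    by (simp_all add: \<omega>_def back_step_def alpha)
  have "\<bar>\<omega> k\<bar> \<le> max (sqrt x) 1" for k
    by (cases k) (use x in \<open>simp_all add: \<omega> le_max_iff_disj\<close>)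
  then show "bounded (range (back_step (sqrt x) \<alpha>))"
    by (auto simp: bounded_iff \<omega>_def)
  have Suc_case: "(\<Prod>i<j. (\<omega> (Suc k + i))\<^sup>2) = (real k + 2) / (real k + real j + 2)" for j k
  proof (induction j)
    case (Suc j)
    have "(\<omega> (Suc k + j))\<^sup>2 = (real k + real j + 2) / (real k + real j + 3)"
      using \<omega>(2)[of "k + j"] by simp
    moreover have "real k + real (Suc j) + 2 = real k + real j + 3" by simp
    moreover have "real k + real j + 2 > 0" "real k + real j + 3 > 0" by simp_all
    ultimately show ?case by (simp only: prod.lessThan_Suc Suc.IH) simp
  qed simp
  have "(block_weight \<omega> l n)\<^sup>2
      = (if n = 0 then 2 * x / (real l + 1) else (real n + 1) / (real n + real l + 1))"
  proof (cases n)
    case 0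
    obtain j where j: "l = Suc j" using l by (cases l) auto
    have "(block_weight \<omega> l n)\<^sup>2 = (\<omega> 0)\<^sup>2 * (\<Prod>i<j. (\<omega> (Suc 0 + i))\<^sup>2)"
      unfolding block_weight_def j prod.lessThan_Suc_shift 0
      by (simp add: power_mult_distrib prod_power_distrib)
    then show ?thesis using 0 x j unfolding Suc_case by (simp add: \<omega> add.commute)
  next
    case (Suc k)
    then show ?thesis
      using Suc_case[of k l] by (simp add: block_weight_def prod_power_distrib algebra_simps)
  qed
  then show "(block_weight (back_step (sqrt x) \<alpha>) l n)\<^sup>2
      = (if n = 0 then 2 * x / (real l + 1) else (real n + 1) / (real n + real l + 1))"
    by (simp add: \<omega>_def)
qed

text \<open>The class of \<open>r\<close> modulo \<open>l\<close> has squared weights \<open>(k + b) / (k + 1 + b)\<close> with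
  \<open>b = (r + 1) / l\<close>; only the class of \<open>0\<close> sees \<open>x\<close>.\<close>
lemma quadratically_hyponormal_bergman_backstep_power:
  fixes x y a :: real and \<alpha> :: "nat \<Rightarrow> real" and l :: nat
  assumes alpha: "\<And>n. \<alpha> n = sqrt ((real n + 2) / (real n + 3))" and x: "x > 0" and l: "l \<ge> 2"
    and a: "a = 1 / real l" and y: "y = 2 * x / (real l + 1)"
    and y1: "y * (2 + a) \<le> 1 + a"
    and c1: "y * (647 + 301 * a + 81 * a^2 + 27 * a^3) \<le> 310 + 337 * a + 54 * a^2 + 27 * a^3"
  shows "quadratically_hyponormal (weighted_shift (back_step (sqrt x) \<alpha>) ^^ l)"
proof -
  define u where "u n = (if n = 0 then y else (real n + 1) / (real n + real l + 1))" for n :: nat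
  have l0: "l > 0" using l by simp
  note B = bergman_backstep_power[OF alpha x l0]
  have "splits l u t" if t: "t \<ge> 0" for t
  proof (rule splits_residue_classes[OF l0])
    fix r assume "r < l"
    show "splits 1 (\<lambda>k. u (r + k * l)) t"
    proof (cases "r = 0")
      case True
      have "splits 1 (\<lambda>k. u (k * l)) t"
      proof (rule splits_perturbed_bergman_type[OF _ _ _ y1 c1 _ _ t])
        show "u (k * l) = (real k + a) / (real k + 1 + a)" if "k \<ge> 1" for k
          using that l0 by (simp add: u_def a divide_simps) (simp add: algebra_simps)
      qed (use l x in \<open>simp_all add: a y u_def\<close>)
      with True show ?thesis by simp
    next
      case False
      define b where "b = (real r + 1) / real l"
      have "(\<lambda>k. u (r + k * l)) = (\<lambda>k. (real k + b) / (real k + 1 + b))"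
      proof
        fix k
        have "real k + b = (real (r + k * l) + 1) / real l"
          "real k + 1 + b = (real (r + k * l) + real l + 1) / real l"
          using l0 by (simp_all add: b_def field_simps)
        then show "u (r + k * l) = (real k + b) / (real k + 1 + b)"
          using False l0 by (simp add: u_def)
      qed
      moreover have "b > 0" using l0 by (simp add: b_def)
      ultimately show ?thesis using splits_bergman_type[OF _ t] by simp
    qed
  qed
  moreover have "u n = (block_weight (back_step (sqrt x) \<alpha>) l n)\<^sup>2" for n
    unfolding B(2) by (simp add: u_def y)
  ultimately show ?thesis
    by (intro quadratically_hyponormal_of_splits[OF B(1)])
qed

theorem corollary5p5:
  fixes x :: real and \<alpha> :: "nat \<Rightarrow> real"
  assumes alpha: "\<And>n. \<alpha> n = sqrt ((real n + 2) / (real n + 3))"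
    and x_pos: "x > 0"
  shows "(quadratically_hyponormal (weighted_shift (back_step (sqrt x) \<alpha>) ^^ 2) \<longleftrightarrow> x \<le> 9 / 10) \<and>
    (\<forall>l :: nat. l \<ge> 3 \<longrightarrow>
       x \<le> (real l + 1)^2 * (1 + 7 * real l + 34 * real l ^ 2 + 44 * real l ^ 3)
           / (2 * (1 + 9 * real l + 45 * real l ^ 2 + 99 * real l ^ 3 + 94 * real l ^ 4)) \<longrightarrow>
       quadratically_hyponormal (weighted_shift (back_step (sqrt x) \<alpha>) ^^ l))"
proof (intro conjI iffI allI impI)
  assume "quadratically_hyponormal (weighted_shift (back_step (sqrt x) \<alpha>) ^^ 2)"
  from quadratically_hyponormal_imp_weight_le[OF bergman_backstep_power(1)[OF alpha x_pos pos2] refl this]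
  show "x \<le> 9 / 10"
    by (simp add: bergman_backstep_power(2)[OF alpha x_pos pos2])
next
  assume "x \<le> 9 / 10"
  then show "quadratically_hyponormal (weighted_shift (back_step (sqrt x) \<alpha>) ^^ 2)"
    by (intro quadratically_hyponormal_bergman_backstep_power[OF alpha x_pos _ refl refl])
       (simp_all add: power2_eq_square power3_eq_cube)
next
  fix l :: nat
  assume l: "l \<ge> 3"
  define L where "L = real l"
  define a where "a = 1 / L"
  define y where "y = 2 * x / (L + 1)"
  \<comment> \<open>In terms of \<open>a = 1 / l\<close> and \<open>y\<close> the bound on \<open>x\<close> reads \<open>y \<le> P / Q\<close>, so an affine bound on \<open>y\<close>
    has to be checked only at \<open>P / Q\<close>.\<close>
  define Q where "Q = 94 + 99 * a + 45 * a^2 + 9 * a^3 + a^4"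
  define P where "P = (1 + a) * (44 + 34 * a + 7 * a^2 + a^3)"
  assume "x \<le> (real l + 1)^2 * (1 + 7 * real l + 34 * real l ^ 2 + 44 * real l ^ 3)
    / (2 * (1 + 9 * real l + 45 * real l ^ 2 + 99 * real l ^ 3 + 94 * real l ^ 4))"
  then have x_le: "x \<le> (L + 1)^2 * (1 + 7 * L + 34 * L^2 + 44 * L^3)
    / (2 * (1 + 9 * L + 45 * L^2 + 99 * L^3 + 94 * L^4))" by (simp add: L_def)
  have L: "L \<ge> 3" using l by (simp add: L_def)
  then have a: "0 < a" "a \<le> 1 / 3" by (simp_all add: a_def divide_simps)
  have Q_pos: "Q > 0" using a by (simp add: Q_def add_pos_nonneg)
  have Q_L: "1 + 9 * L + 45 * L^2 + 99 * L^3 + 94 * L^4 = L^4 * Q"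
    and P_L: "(L + 1) * (1 + 7 * L + 34 * L^2 + 44 * L^3) = L^4 * P"
    using L by (simp_all add: Q_def P_def a_def field_simps power2_eq_square power3_eq_cube power4_eq_xxxx)
  have "x \<le> (L + 1) * P / (2 * Q)"
  proof -
    have "(L + 1)^2 * (1 + 7 * L + 34 * L^2 + 44 * L^3) = L^4 * ((L + 1) * P)"
      using P_L by (simp add: power2_eq_square mult.assoc mult.left_commute)
    with x_le L show ?thesis unfolding Q_L by simp
  qed
  then have yQ: "y * Q \<le> P"
    using L Q_pos by (simp add: y_def field_simps)
  have y_le: "y * d \<le> n" if "0 \<le> d" "d * P \<le> n * Q" for d n
    using affine_nonneg_below_ratio[OF yQ Q_pos that] by (simp add: mult.commute)
  have "quadratically_hyponormal (weighted_shift (back_step (sqrt x) \<alpha>) ^^ l)"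
  proof (rule quadratically_hyponormal_bergman_backstep_power[OF alpha x_pos])
    show "a = 1 / real l" "y = 2 * x / (real l + 1)"
      by (simp_all add: a_def y_def L_def)
    show "y * (2 + a) \<le> 1 + a"
    proof (rule y_le)
      have "(1 + a) * Q - (2 + a) * P = (1 + a) * (6 - 13 * a - 3 * (a * a))"
        unfolding Q_def P_def by algebra
      moreover have "a * a \<le> 1 / 3 * (1 / 3)" using a by (intro mult_mono) auto
      then have "0 \<le> 6 - 13 * a - 3 * (a * a)" using a by linarith
      ultimately show "(2 + a) * P \<le> (1 + a) * Q"
        using a by (metis add_nonneg_nonneg diff_ge_0_iff_ge less_imp_le mult_nonneg_nonneg zero_le_one)
    qed (use a in simp)
    show "y * (647 + 301 * a + 81 * a^2 + 27 * a^3) \<le> 310 + 337 * a + 54 * a^2 + 27 * a^3"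
    proof (rule y_le)
      have "(310 + 337 * a + 54 * a^2 + 27 * a^3) * Q - (647 + 301 * a + 81 * a^2 + 27 * a^3) * P
          = 672 - 1342 * a - 1180 * (a * a) + a^3 * (816 - 36 * a - 18 * (a * a))"
        unfolding Q_def P_def by algebra
      moreover have "a * a \<le> 1 / 3 * (1 / 3)" using a by (intro mult_mono) auto
      then have "0 \<le> 672 - 1342 * a - 1180 * (a * a)" "0 \<le> a^3 * (816 - 36 * a - 18 * (a * a))"
        using a by (linarith, intro mult_nonneg_nonneg) auto
      ultimately show "(647 + 301 * a + 81 * a^2 + 27 * a^3) * P
          \<le> (310 + 337 * a + 54 * a^2 + 27 * a^3) * Q"
        by linarith
    qed (use a in \<open>auto intro!: add_nonneg_nonneg\<close>)
  qed (use l in simp)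
  then show "quadratically_hyponormal (weighted_shift (back_step (sqrt x) \<alpha>) ^^ l)" .
qed

end
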